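(* Let $T$ be a regular interval exchange transformation on a semi-interval $[\ell,r[$ defined over a quadratic field. Then the family of all transformations induced by $T$ on semi-intervals $I\subseteq[\ell,r[$ that are admissible for $T$ contains only finitely many distinct transformations up to equivalence.
   Context: A semi-interval is a set $[x,y[=\{z\in\mathbb{R}: x\le z<y\}$ with $x<y$. Let $A=\{a_1<\dots<a_s\}$ be a finite ordered alphabet, $\lambda=(\lambda_1,\dots,\lambda_s)$ positive reals with $\sum\lambda_i=r-\ell$, and $\pi$ a permutation of $A$. Put $\gamma_{a_i}=\ell+\sum_{j<i}\lambda_j$ and $\delta_{a_i}=\ell+\sum_{j:\pi(a_j)<\pi(a_i)}\lambda_j$, and $I_{a_i}=[\gamma_{a_i},\gamma_{a_i}+\lambda_i[$. The $s$-interval exchange transformation $T=T_{\pi,\lambda}:[\ell,r[\to[\ell,r[$ is $T(z)=z+\delta_a-\gamma_a$ for $z\in I_a$; it is a bijection. The separation points are $\gamma_1=\ell,\gamma_2,\dots,\gamma_s$ (writing $\gamma_i=\gamma_{a_i}$). $T$ is regular if the orbits $\{T^n(\gamma_i):n\in\mathbb{Z}\}$ of $\gamma_2,\dots,\gamma_s$ are infinite and pairwise disjoint (regular transformations are minimal: every orbit is dense). $T$ is defined over a quadratic field if all $\lambda_i$ lie in a field $\mathbb{Q}(\sqrt d)$ with $d\ge2$ a square-free integer. Admissibility: for $I=[u,v[\subseteq[\ell,r[$ and $z\in[\ell,r[$ let $\rho^+_{I,T}(z)=\min\{n>0: T^n(z)\in\,]u,v[\}$, $\rho^-_{I,T}(z)=\min\{n\ge0: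 T^{-n}(z)\in\,]u,v[\}$, $N_{I,T}(z)=\{T^k(z): -\rho^-_{I,T}(z)\le k<\rho^+_{I,T}(z)\}$ and $\mathrm{Div}(I,T)=\bigcup_{i=1}^s N_{I,T}(\gamma_i)$. The semi-interval $I=[u,v[$ with $\ell\le u<v\le r$ is admissible for $T$ if $u,v\in\mathrm{Div}(I,T)\cup\{r\}$. Induced transformation: for a semi-interval $I\subseteq[\ell,r[$ and $T$ minimal, the transformation induced by $T$ on $I$ is $S:I\to I$, $S(z)=T^n(z)$ with $n=\min\{n>0: T^n(z)\in I\}$. For regular $T$ and admissible $I$ this is again a (regular) $s$-interval exchange transformation. Equivalence: two $s$-interval exchange transformations $T_{\pi,\lambda}$ and $T_{\sigma,\mu}$ are equivalent if either $\sigma=\pi$ and $\mu=c\lambda$ for some $c>0$, or $\sigma=\tau\circ\pi$ and $\mu=c\widetilde\lambda$ for some $c>0$, where $\tau:i\mapsto s-i+1$ and $\widetilde\lambda=(\lambda_s,\dots,\lambda_1)$ (the position $\ell$ of the domain is irrelevant). *)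

theory Defs
  imports
    Complex_Main
    "HOL-Combinatorics.Permutations"
    "HOL-Computational_Algebra.Squarefree"
begin

section \<open>Interval exchange transformations\<close>

text \<open>
  The ordered alphabet is \<open>1 < \<dots> < s\<close>. Only the values of the
  lengths on \<open>{1..s}\<close> are significant.
\<close>

record iet =
  iet_left :: real
  iet_num :: nat
  iet_len :: "nat \<Rightarrow> real"
  iet_perm :: "nat \<Rightarrow> nat"

definition is_iet :: "iet \<Rightarrow> bool" where
  "is_iet D \<longleftrightarrow>
     iet_num D \<ge> 1 \<and>
     (\<forall>i\<in>{1..iet_num D}. iet_len D i > 0) \<and>
     iet_perm D permutes {1..iet_num D}"

definition iet_right :: "iet \<Rightarrow> real" where
  "iet_right D = iet_left D + (\<Sum>i\<in>{1..iet_num D}. iet_len D i)"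

definition iet_dom :: "iet \<Rightarrow> real set" where
  "iet_dom D = {iet_left D..<iet_right D}"

definition iet_gamma :: "iet \<Rightarrow> nat \<Rightarrow> real" where
  "iet_gamma D i = iet_left D + (\<Sum>j\<in>{1..<i}. iet_len D j)"

definition iet_delta :: "iet \<Rightarrow> nat \<Rightarrow> real" where
  "iet_delta D i =
     iet_left D + (\<Sum>j\<in>{j\<in>{1..iet_num D}. iet_perm D j < iet_perm D i}. iet_len D j)"

definition iet_interval :: "iet \<Rightarrow> nat \<Rightarrow> real set" where
  "iet_interval D i = {iet_gamma D i..<iet_gamma D i + iet_len D i}"

definition iet_letter :: "iet \<Rightarrow> real \<Rightarrow> nat" where
  "iet_letter D z = (THE i. i \<in> {1..iet_num D} \<and> z \<in> iet_interval D i)"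

text \<open>
  The map is extended by the identity outside its domain. It is thereby a bijection
  of the whole real line whose inverse extends the inverse on the domain, and the
  iterates, forward and backward, of a point of the domain stay in the domain.
\<close>

definition iet_map :: "iet \<Rightarrow> real \<Rightarrow> real" where
  "iet_map D z =
     (if z \<in> iet_dom D
      then z + iet_delta D (iet_letter D z) - iet_gamma D (iet_letter D z)
      else z)"

definition iet_pow :: "iet \<Rightarrow> int \<Rightarrow> real \<Rightarrow> real" where
  "iet_pow D n z =
     (if n \<ge> 0 then (iet_map D ^^ nat n) z else (inv (iet_map D) ^^ nat (- n)) z)"

definition iet_orbit :: "iet \<Rightarrow> real \<Rightarrow> real set" where
  "iet_orbit D z = {iet_pow D n z | n. True}"

definition regular_iet :: "iet \<Rightarrow> bool" where
  "regular_iet D \<longleftrightarrow>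
     is_iet D \<and>
     (\<forall>i\<in>{2..iet_num D}. infinite (iet_orbit D (iet_gamma D i))) \<and>
     (\<forall>i\<in>{2..iet_num D}. \<forall>j\<in>{2..iet_num D}. i \<noteq> j \<longrightarrow>
        iet_orbit D (iet_gamma D i) \<inter> iet_orbit D (iet_gamma D j) = {})"

definition quadratic_field :: "int \<Rightarrow> real set" where
  "quadratic_field d = {a + b * sqrt (of_int d) | a b. a \<in> \<rat> \<and> b \<in> \<rat>}"

definition over_quadratic_field :: "iet \<Rightarrow> bool" where
  "over_quadratic_field D \<longleftrightarrow>
     (\<exists>d::int. d \<ge> 2 \<and> squarefree d \<and>
        (\<forall>i\<in>{1..iet_num D}. iet_len D i \<in> quadratic_field d))"

section \<open>Admissible semi-intervals\<close>

definition rho_plus :: "iet \<Rightarrow> real \<Rightarrow> real \<Rightarrow> real \<Rightarrow> nat" where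
  "rho_plus D u v z = (LEAST n. n > 0 \<and> iet_pow D (int n) z \<in> {u<..<v})"

definition rho_minus :: "iet \<Rightarrow> real \<Rightarrow> real \<Rightarrow> real \<Rightarrow> nat" where
  "rho_minus D u v z = (LEAST n. iet_pow D (- int n) z \<in> {u<..<v})"

definition iet_neighbours :: "iet \<Rightarrow> real \<Rightarrow> real \<Rightarrow> real \<Rightarrow> real set" where
  "iet_neighbours D u v z =
     {iet_pow D k z | k. - int (rho_minus D u v z) \<le> k \<and> k < int (rho_plus D u v z)}"

definition Div :: "iet \<Rightarrow> real \<Rightarrow> real \<Rightarrow> real set" where
  "Div D u v = (\<Union>i\<in>{1..iet_num D}. iet_neighbours D u v (iet_gamma D i))"

definition admissible :: "iet \<Rightarrow> real \<Rightarrow> real \<Rightarrow> bool" where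
  "admissible D u v \<longleftrightarrow>
     iet_left D \<le> u \<and> u < v \<and> v \<le> iet_right D \<and>
     u \<in> Div D u v \<union> {iet_right D} \<and> v \<in> Div D u v \<union> {iet_right D}"

section \<open>Transformations and their equivalence\<close>

text \<open>
  A transformation of a semi-interval is a partial map whose domain is exactly that
  semi-interval, so that equality of partial maps is equality of transformations,
  domains included.
\<close>

definition iet_transformation :: "iet \<Rightarrow> real \<rightharpoonup> real" where
  "iet_transformation D = (\<lambda>z. Some (iet_map D z)) |` iet_dom D"

definition first_return :: "iet \<Rightarrow> real \<Rightarrow> real \<Rightarrow> real \<Rightarrow> nat" where
  "first_return D u v z = (LEAST n. n > 0 \<and> (iet_map D ^^ n) z \<in> {u..<v})"

definition induced_transformation :: "iet \<Rightarrow> real \<Rightarrow> real \<Rightarrow> real \<rightharpoonup> real" where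
  "induced_transformation D u v =
     (\<lambda>z. Some ((iet_map D ^^ first_return D u v z) z)) |` {u..<v}"

definition admissible_induced :: "iet \<Rightarrow> (real \<rightharpoonup> real) set" where
  "admissible_induced D = {induced_transformation D u v | u v. admissible D u v}"

definition iet_equiv :: "iet \<Rightarrow> iet \<Rightarrow> bool" where
  "iet_equiv D E \<longleftrightarrow>
     iet_num D = iet_num E \<and>
     (\<exists>c>0.
        (\<forall>i\<in>{1..iet_num D}.
           iet_perm E i = iet_perm D i \<and> iet_len E i = c * iet_len D i) \<or>
        (\<forall>i\<in>{1..iet_num D}.
           iet_perm E i = iet_num D - iet_perm D i + 1 \<and>
           iet_len E i = c * iet_len D (iet_num D - i + 1)))"

text \<open>
  Equivalence of transformations refers to their presentations by exactly \<open>s\<close>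
  intervals, without which subdividing intervals would give a transformation many
  presentations. In particular, only \<open>s\<close>-interval exchange transformations
  are equivalent to anything.
\<close>

definition transformation_equiv :: "nat \<Rightarrow> (real \<rightharpoonup> real) \<Rightarrow> (real \<rightharpoonup> real) \<Rightarrow> bool" where
  "transformation_equiv s S R \<longleftrightarrow>
     (\<exists>D E. is_iet D \<and> is_iet E \<and> iet_num D = s \<and> iet_num E = s \<and>
        S = iet_transformation D \<and> R = iet_transformation E \<and> iet_equiv D E)"

end

theory Submission
  imports Defs "HOL-Analysis.Analysis"
begin

text \<open>
  After clearing denominators, all lengths are quadratic integers \<open>a + b sqrt d\<close>, and a
  translation by \<open>T\<^sup>n\<close> has a conjugate of size \<open>O(n)\<close>. As nonzero norms are at least 1,
  points obtained from the separation points in at most \<open>n\<close> steps are \<open>c / n\<close> apart. Hence the set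
  of points that hit a given semi-interval of length \<open>L\<close> (with suitable endpoints) first at time
  \<open>t\<close> has measure at least \<open>c / (t + 1 / L)\<close> unless every point has hit it before. The harmonic
  series diverges, so all hitting times are \<open>O(1 / L)\<close>.

  The lengths of the transformation induced on an admissible semi-interval of length \<open>L\<close> are
  differences of points reached from separation points within one return, so they are at most
  \<open>L\<close> with conjugates \<open>O(1 / L)\<close>. The ratio of two of them is a quadratic integer of bounded size
  and conjugate, divided by a norm of bounded size; only finitely many ratios occur.
\<close>

text \<open>The ends u and v of an admissible semi-interval lie on orbits of separation points, but
  the number of steps leading to them is bounded only by the return times that are still to be
  estimated; taking them as marked points would be circular. Hitting times are therefore bounded for
  every semi-interval of length L: inside it lies a smaller one whose ends, measured from the left
  end of the domain, are in Q(sqrt d) with conjugate O(1 / L). Dirichlet approximation supplies such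
  ends. Admissibility enters only afterwards, to cut the induced map into exactly s pieces.

  The harmonic series gives more than finiteness: the sum of 1 / (t + 1 / L) for t up to M is about
  ln (1 + M * L), so a constant bound on it, the total length over c, bounds M * L.\<close>

section \<open>Quadratic integers\<close>

text \<open>\<open>N\<close> is a common denominator, and \<open>B\<close> bounds the conjugate of
  \<open>N * x\<close>, not of \<open>x\<close>. Quantifying over the coordinates avoids conjugation
  as a function on the field.\<close>

definition qint :: "int \<Rightarrow> nat \<Rightarrow> real \<Rightarrow> real \<Rightarrow> bool" where
  "qint d N B x \<longleftrightarrow>
     (\<exists>(a::int) (b::int). real N * x = a + b * sqrt d \<and> \<bar>a - b * sqrt d\<bar> \<le> B)"

lemma qint_mono: "qint d N B x \<Longrightarrow> B \<le> C \<Longrightarrow> qint d N C x"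
  unfolding qint_def by (meson order_trans)

lemma qint_0: "0 \<le> B \<Longrightarrow> qint d N B 0"
  unfolding qint_def by (rule exI[of _ 0], rule exI[of _ 0]) auto

lemma qint_nonneg: "qint d N B x \<Longrightarrow> 0 \<le> B"
  unfolding qint_def by (metis abs_ge_zero order_trans)

lemma qint_add:
  assumes "qint d N B x" "qint d N C y"
  shows "qint d N (B + C) (x + y)"
proof -
  obtain a b :: int where 1: "real N * x = a + b * sqrt d" "\<bar>a - b * sqrt d\<bar> \<le> B"
    using assms(1) unfolding qint_def by blast
  obtain a' b' :: int where 2: "real N * y = a' + b' * sqrt d" "\<bar>a' - b' * sqrt d\<bar> \<le> C"
    using assms(2) unfolding qint_def by blast
  show ?thesis
    unfolding qint_def
    by (rule exI[of _ "a + a'"], rule exI[of _ "b + b'"]) (use 1 2 in \<open>simp add: algebra_simps\<close>)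
qed

lemma qint_minus:
  assumes "qint d N B x"
  shows "qint d N B (- x)"
proof -
  obtain a b :: int where 1: "real N * x = a + b * sqrt d" "\<bar>a - b * sqrt d\<bar> \<le> B"
    using assms(1) unfolding qint_def by blast
  show ?thesis
    unfolding qint_def
    by (rule exI[of _ "- a"], rule exI[of _ "- b"]) (use 1 in \<open>simp add: algebra_simps\<close>)
qed

lemma qint_diff: "qint d N B x \<Longrightarrow> qint d N C y \<Longrightarrow> qint d N (B + C) (x - y)"
  using qint_add[OF _ qint_minus] by fastforce

lemma qint_sum:
  assumes "\<And>i. i \<in> A \<Longrightarrow> qint d N B (g i)" "finite A"
  shows "qint d N (real (card A) * B) (sum g A)"
  using assms(2,1)
proof (induction A rule: finite_induct)
  case empty
  then show ?case by (simp add: qint_0)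
next
  case (insert x F)
  have "qint d N (B + real (card F) * B) (g x + sum g F)"
    by (intro qint_add insert) auto
  then show ?case using insert by (simp add: algebra_simps)
qed

text \<open>Irrationality of sqrt d, in the form that makes the norm vanish only at 0: a nonzero b
  would divide a, and the quotient would have square d.\<close>

lemma squarefree_mult_square_eq_square:
  fixes d a b :: int
  assumes "d \<ge> 2" "squarefree d" "a\<^sup>2 = d * b\<^sup>2"
  shows "a = 0 \<and> b = 0"
proof (rule ccontr)
  assume n: "\<not> (a = 0 \<and> b = 0)"
  have b: "b \<noteq> 0" using n assms by auto
  have "b\<^sup>2 dvd a\<^sup>2" using assms by auto
  then have "b dvd a" by simp
  then obtain k where k: "a = b * k" by blast
  have "k\<^sup>2 = d" using assms(3) b by (auto simp: k power_mult_distrib)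
  then have "k\<^sup>2 dvd d" by simp
  then have "is_unit k" using assms(2) unfolding squarefree_def by blast
  then have "k\<^sup>2 = 1" by (metis zdvd1_eq power2_abs one_power2)
  then show False using \<open>k\<^sup>2 = d\<close> assms by simp
qed

lemma int_mem_ceiling_interval:
  "\<bar>real_of_int m\<bar> \<le> M \<Longrightarrow> m \<in> {- \<lceil>M\<rceil>..\<lceil>M\<rceil>}"
  by (simp add: abs_le_iff) linarith

locale quadratic =
  fixes d :: int and N :: nat
  assumes d: "d \<ge> 2" "squarefree d" and N: "N > 0"
begin

lemma norm_ge_1:
  fixes a b :: int
  assumes "a \<noteq> 0 \<or> b \<noteq> 0"
  shows "1 \<le> \<bar>a + b * sqrt d\<bar> * \<bar>a - b * sqrt d\<bar>"
proof -
  have "a\<^sup>2 - d * b\<^sup>2 \<noteq> 0"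
    using squarefree_mult_square_eq_square[OF d, of a b] assms by auto
  then have "1 \<le> \<bar>a\<^sup>2 - d * b\<^sup>2\<bar>" by linarith
  then have "1 \<le> \<bar>real_of_int (a\<^sup>2 - d * b\<^sup>2)\<bar>" by linarith
  also have "real_of_int (a\<^sup>2 - d * b\<^sup>2) = (a + b * sqrt d) * (a - b * sqrt d)"
    using d by (simp add: algebra_simps power2_eq_square)
  finally show ?thesis by (simp add: abs_mult)
qed

text \<open>The norm of \<open>N * x\<close> is a nonzero integer, so \<open>x\<close> and its
  conjugate cannot both be small.\<close>

lemma qint_lower:
  assumes "qint d N B x" "x \<noteq> 0"
  shows "1 \<le> real N * \<bar>x\<bar> * B"
proof -
  obtain a b :: int where 1: "real N * x = a + b * sqrt d" "\<bar>a - b * sqrt d\<bar> \<le> B"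
    using assms(1) unfolding qint_def by blast
  have "a \<noteq> 0 \<or> b \<noteq> 0" using 1 assms(2) N by auto
  from norm_ge_1[OF this] have "1 \<le> \<bar>real N * x\<bar> * \<bar>a - b * sqrt d\<bar>" by (simp add: 1)
  also have "\<dots> \<le> \<bar>real N * x\<bar> * B" using 1 by (intro mult_left_mono) auto
  finally show ?thesis by (simp add: abs_mult)
qed

text \<open>The two coordinates come from half the sum and half the difference of
  \<open>N * x\<close> and its conjugate, hence are bounded integers.\<close>

lemma finite_bounded_qint:
  "finite {x. qint d N B x \<and> \<bar>x\<bar> \<le> C}"
proof -
  let ?M = "real N * C + \<bar>B\<bar>"
  let ?S = "{- \<lceil>?M\<rceil>..\<lceil>?M\<rceil>} :: int set"
  have "{x. qint d N B x \<and> \<bar>x\<bar> \<le> C} \<subseteq> (\<lambda>(a, b). (a + b * sqrt d) / N) ` (?S \<times> ?S)"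
  proof
    fix x assume "x \<in> {x. qint d N B x \<and> \<bar>x\<bar> \<le> C}"
    then have x: "qint d N B x" "\<bar>x\<bar> \<le> C" by auto
    obtain a b :: int where 1: "real N * x = a + b * sqrt d" "\<bar>a - b * sqrt d\<bar> \<le> B"
      using x(1) unfolding qint_def by blast
    have "\<bar>real N * x\<bar> \<le> real N * C" using x(2) N by (simp add: abs_mult)
    then have 2: "\<bar>a + b * sqrt d\<bar> \<le> real N * C" using 1 by simp
    have s: "sqrt d \<ge> 1" using d by simp
    have "2 * \<bar>real_of_int a\<bar> \<le> \<bar>a + b * sqrt d\<bar> + \<bar>a - b * sqrt d\<bar>" by linarith
    then have a: "\<bar>real_of_int a\<bar> \<le> ?M" using 1 2 by linarith
    have "2 * \<bar>real_of_int b * sqrt d\<bar> \<le> \<bar>a + b * sqrt d\<bar> + \<bar>a - b * sqrt d\<bar>" by linarith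
    then have "\<bar>real_of_int b * sqrt d\<bar> \<le> ?M" using 1 2 by linarith
    moreover have "\<bar>real_of_int b\<bar> * 1 \<le> \<bar>real_of_int b\<bar> * sqrt d" using s by (intro mult_left_mono) auto
    ultimately have b: "\<bar>real_of_int b\<bar> \<le> ?M" using s by (simp add: abs_mult)
    have "a \<in> ?S" "b \<in> ?S" using int_mem_ceiling_interval[OF a] int_mem_ceiling_interval[OF b] by blast+
    moreover have "x = (a + b * sqrt d) / N" using 1 N by (simp add: field_simps)
    ultimately show "x \<in> (\<lambda>(a, b). (a + b * sqrt d) / N) ` (?S \<times> ?S)" by force
  qed
  then show ?thesis by (rule finite_subset) auto
qed

text \<open>
  The quotient is \<open>x y' / (y y')\<close> for the conjugate \<open>y'\<close> of \<open>y\<close>: the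
  denominator is a nonzero integer and the numerator a quadratic integer, both bounded,
  as is the conjugate of the numerator.
\<close>

lemma finite_ratios:
  "finite {x / y | x y L. L > 0 \<and> 0 < x \<and> x \<le> L \<and> 0 < y \<and> y \<le> L \<and>
      qint d N (C / L) x \<and> qint d N (C / L) y}" (is "finite ?R")
proof -
  let ?M = "\<bar>real N * C\<bar>"
  let ?X = "{z. qint d 1 ?M z \<and> \<bar>z\<bar> \<le> ?M}"
  let ?Y = "{- \<lceil>?M\<rceil>..\<lceil>?M\<rceil>} :: int set"
  interpret one: quadratic d 1 using d by unfold_locales auto
  have "?R \<subseteq> (\<lambda>(z, m). z / real_of_int m) ` (?X \<times> ?Y)"
  proof
    fix r assume "r \<in> ?R"
    then obtain x y L where r: "r = x / y" "L > 0" "0 < x" "x \<le> L" "0 < y" "y \<le> L"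
      and q: "qint d N (C / L) x" "qint d N (C / L) y" by blast
    obtain a b :: int where 1: "real N * x = a + b * sqrt d" "\<bar>a - b * sqrt d\<bar> \<le> C / L"
      using q(1) unfolding qint_def by blast
    obtain a' b' :: int where 2: "real N * y = a' + b' * sqrt d" "\<bar>a' - b' * sqrt d\<bar> \<le> C / L"
      using q(2) unfolding qint_def by blast
    \<comment> \<open>\<open>?z\<close> is \<open>N * x\<close> times the conjugate of
      \<open>N * y\<close>, \<open>?zc\<close> is its conjugate, and \<open>?m\<close> is the norm
      of \<open>N * y\<close>.\<close>
    let ?z = "(a + b * sqrt d) * (a' - b' * sqrt d)"
    let ?zc = "(a - b * sqrt d) * (a' + b' * sqrt d)"
    let ?m = "a'\<^sup>2 - d * b'\<^sup>2"
    have sd: "sqrt d * sqrt d = d" using d by simp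
    have z: "?z = (a * a' - d * b * b') + (b * a' - a * b') * sqrt d"
      using sd by (simp add: algebra_simps)
    have zc: "?zc = (a * a' - d * b * b') - (b * a' - a * b') * sqrt d"
      using sd by (simp add: algebra_simps)
    have m: "real_of_int ?m = (a' + b' * sqrt d) * (a' - b' * sqrt d)"
      using sd by (simp add: algebra_simps power2_eq_square)
    \<comment> \<open>One factor is at most \<open>N * L\<close>, the other, a conjugate, at most
      \<open>C / L\<close>: the scale L cancels.\<close>
    have bd: "\<bar>(real N * t) * w\<bar> \<le> ?M" if "0 < t" "t \<le> L" "\<bar>w\<bar> \<le> C / L" for t w
    proof -
      have "\<bar>(real N * t) * w\<bar> = (real N * t) * \<bar>w\<bar>" using that N by (simp add: abs_mult)
      also have "\<dots> \<le> (real N * L) * (C / L)" using that N r by (intro mult_mono) auto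
      also have "\<dots> = real N * C" using r by simp
      finally show ?thesis by linarith
    qed
    have zb: "\<bar>?z\<bar> \<le> ?M" using bd[OF r(3,4) 2(2)] 1 by simp
    have zcb: "\<bar>?zc\<bar> \<le> ?M" using bd[OF r(5,6) 1(2)] 2 by (simp add: mult.commute)
    have mb: "\<bar>real_of_int ?m\<bar> \<le> ?M" using bd[OF r(5,6) 2(2)] 2 m by simp
    have zX: "?z \<in> ?X"
      using zb zcb unfolding qint_def mem_Collect_eq z zc
      by (intro conjI exI[of _ "a * a' - d * b * b'"] exI[of _ "b * a' - a * b'"]) auto
    have mY: "?m \<in> ?Y" by (rule int_mem_ceiling_interval[OF mb])
    have n0: "a' + b' * sqrt d \<noteq> 0" using 2 N r by (metis mult_pos_pos of_nat_0_less_iff order_less_irrefl)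
    then have "a' \<noteq> 0 \<or> b' \<noteq> 0" by auto
    then have c0: "a' - b' * sqrt d \<noteq> 0" using norm_ge_1[of a' b'] by auto
    have "r = (real N * x) / (real N * y)" using r N by simp
    also have "\<dots> = ?z / ?m" unfolding 1 2 m using c0 n0 by simp
    finally show "r \<in> (\<lambda>(z, m). z / real_of_int m) ` (?X \<times> ?Y)"
      using zX mY by (intro image_eqI[where x = "(?z, ?m)"]) auto
  qed
  moreover have "finite ?X" by (rule one.finite_bounded_qint)
  ultimately show ?thesis by (meson finite_SigmaI finite_atLeastAtMost_int finite_imageI finite_subset)
qed

section \<open>Approximation of reals by quadratic integers with controlled conjugates\<close>

lemma qint_mult_int:
  assumes "qint d N B x"
  shows "qint d N (\<bar>real_of_int j\<bar> * B) (j * x)"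
proof -
  obtain a b :: int where 1: "real N * x = a + b * sqrt d" "\<bar>a - b * sqrt d\<bar> \<le> B"
    using assms(1) unfolding qint_def by blast
  have "\<bar>(j * a) - (j * b) * sqrt d\<bar> = \<bar>real_of_int j\<bar> * \<bar>a - b * sqrt d\<bar>"
    unfolding abs_mult[symmetric] by (rule arg_cong[where f = abs]) (simp add: algebra_simps)
  also have "\<dots> \<le> \<bar>real_of_int j\<bar> * B" using 1 by (intro mult_left_mono) auto
  finally have 2: "\<bar>(j * a) - (j * b) * sqrt d\<bar> \<le> \<bar>real_of_int j\<bar> * B" .
  have 3: "real N * (j * x) = (j * a) + (j * b) * sqrt d"
  proof -
    have "real N * (j * x) = j * (real N * x)" by simp
    also have "\<dots> = (j * a) + (j * b) * sqrt d" unfolding 1 by (simp add: algebra_simps)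
    finally show ?thesis .
  qed
  show ?thesis
    unfolding qint_def
    by (rule exI[of _ "j * a"], rule exI[of _ "j * b"]) (use 2 3 in simp)
qed

text \<open>Dirichlet's theorem gives \<open>m * sqrt d - h\<close> below \<open>1 / 2 ^ k\<close>
  with \<open>m\<close> at most \<open>2 ^ k\<close>, hence with conjugate of order
  \<open>2 ^ k\<close>. The norm then keeps it from being much smaller than
  \<open>1 / 2 ^ k\<close>, which will bound the digits of the expansion in
  \<open>qint_dense_dyadic\<close>.\<close>

lemma small_qint:
  obtains C where "C > 0"
    "\<And>k::nat. \<exists>w. 0 < w \<and> w \<le> 1 / 2 ^ k \<and> 1 \<le> C * 2 ^ k * w \<and> qint d N (C * 2 ^ k) w"
proof
  let ?D = "2 * sqrt d + 1"
  \<comment> \<open>\<open>?D\<close> bounds the conjugate of the approximant in units of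
    \<open>2 ^ k\<close>. One factor \<open>N\<close> arises because \<open>qint\<close> measures
    the conjugate of \<open>N\<close> times it, the other comes from
    \<open>qint_lower\<close>.\<close>
  let ?C = "real N * (real N * ?D)"
  have sd: "sqrt d \<ge> 1" using d by simp
  have "?D > 0" using sd by linarith
  then show "?C > 0" using N by (intro mult_pos_pos) auto
  fix k :: nat
  obtain h m where hm: "0 < m" "m \<le> int (2 ^ k)" "\<bar>of_int m * sqrt d - of_int h\<bar> < 1 / real (2 ^ k)"
    using Dirichlet_approx[of "2 ^ k" "sqrt d"] by (metis zero_less_numeral zero_less_power)
  let ?u = "of_int m * sqrt d - of_int h"
  have k1: "(1::real) \<le> 2 ^ k" by simp
  have u1: "\<bar>?u\<bar> < 1 / 2 ^ k" using hm by simp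
  also have "\<dots> \<le> 1" using k1 by (simp add: field_simps)
  finally have "\<bar>?u\<bar> \<le> 1" by simp
  then have "\<bar>of_int m * sqrt d + of_int h\<bar> \<le> 2 * (of_int m * sqrt d) + 1"
  proof -
    have "0 \<le> of_int m * sqrt d" using hm(1) sd by simp
    then show ?thesis using \<open>\<bar>?u\<bar> \<le> 1\<close> by linarith
  qed
  also have "\<dots> \<le> 2 * (2 ^ k * sqrt d) + 1"
  proof -
    have "real_of_int m \<le> real_of_int (int (2 ^ k))" using hm(2) by (simp only: of_int_le_iff)
    then have "real_of_int m \<le> 2 ^ k" by simp
    then show ?thesis using sd by (intro add_mono mult_left_mono mult_right_mono) auto
  qed
  also have "\<dots> \<le> ?D * 2 ^ k" using k1 by (simp add: algebra_simps)
  finally have c: "\<bar>of_int m * sqrt d + of_int h\<bar> \<le> ?D * 2 ^ k" .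
  have q: "qint d N (real N * (?D * 2 ^ k)) ?u"
    unfolding qint_def
  proof (rule exI[of _ "- int N * h"], rule exI[of _ "int N * m"], intro conjI)
    show "real N * ?u = real_of_int (- int N * h) + real_of_int (int N * m) * sqrt d"
      by (simp add: algebra_simps)
    have "\<bar>real_of_int (- int N * h) - real_of_int (int N * m) * sqrt d\<bar>
        = \<bar>- (real N * (of_int m * sqrt d + of_int h))\<bar>"
      by (rule arg_cong[where f = abs]) (simp add: algebra_simps)
    also have "\<dots> = real N * \<bar>of_int m * sqrt d + of_int h\<bar>"
      by (simp only: abs_minus_cancel abs_mult abs_of_nat)
    also have "\<dots> \<le> real N * (?D * 2 ^ k)" using c by (intro mult_left_mono) auto
    finally show "\<bar>real_of_int (- int N * h) - real_of_int (int N * m) * sqrt d\<bar> \<le> real N * (?D * 2 ^ k)" .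
  qed
  have u0: "?u \<noteq> 0"
    using norm_ge_1[of "- h" m] hm(1) by auto
  have q': "qint d N (real N * (?D * 2 ^ k)) \<bar>?u\<bar>"
    using q qint_minus[OF q] by (simp add: abs_if)
  have "1 \<le> real N * \<bar>?u\<bar> * (real N * (?D * 2 ^ k))"
    using qint_lower[OF q u0] .
  then have "1 \<le> ?C * 2 ^ k * \<bar>?u\<bar>" by (simp add: mult_ac)
  moreover have "qint d N (?C * 2 ^ k) \<bar>?u\<bar>"
  proof (rule qint_mono[OF q'])
    have "1 * (real N * (?D * 2 ^ k)) \<le> real N * (real N * (?D * 2 ^ k))"
      using N sd by (intro mult_right_mono) auto
    then show "real N * (?D * 2 ^ k) \<le> ?C * 2 ^ k" by (simp add: mult_ac)
  qed
  ultimately show "\<exists>w. 0 < w \<and> w \<le> 1 / 2 ^ k \<and> 1 \<le> ?C * 2 ^ k * w \<and> qint d N (?C * 2 ^ k) w"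
    using u0 u1 by (intro exI[of _ "\<bar>?u\<bar>"]) auto
qed

text \<open>A greedy expansion: the error is halved by adding an integer multiple of a small number
  of the next scale. The multipliers are bounded, so the conjugates add up like a geometric series,
  dominated by its last term.\<close>

lemma qint_dense_dyadic:
  obtains K where "K > 0"
    "\<And>(k::nat) x. 0 \<le> x \<Longrightarrow> x \<le> R \<Longrightarrow> \<exists>y\<le>x. x < y + 1 / 2 ^ k \<and> qint d N (K * 2 ^ k) y"
proof -
  obtain C where C: "C > 0"
    "\<And>k::nat. \<exists>w. 0 < w \<and> w \<le> 1 / 2 ^ k \<and> 1 \<le> C * 2 ^ k * w \<and> qint d N (C * 2 ^ k) w"
    using small_qint by metis
  \<comment> \<open>\<open>real N * R\<close> serves the initial approximation, the floor of
    \<open>x\<close>. \<open>4 * C * C\<close> is the cost of one refinement in units of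
    \<open>2 ^ k\<close>: a multiplier up to \<open>2 * C\<close> times a conjugate bound
    \<open>C * 2 ^ Suc k\<close>.\<close>
  define K where "K = max (real N * R) (4 * C * C)"
  have K: "K > 0" "real N * R \<le> K" "4 * C * C \<le> K" using C unfolding K_def by (auto simp: less_max_iff_disj)
  show thesis
  proof (rule that[OF K(1)])
    fix k :: nat and x :: real
    assume x: "0 \<le> x" "x \<le> R"
    show "\<exists>y\<le>x. x < y + 1 / 2 ^ k \<and> qint d N (K * 2 ^ k) y"
    proof (induction k)
      case 0
      have "qint d N K (of_int \<lfloor>x\<rfloor>)"
        unfolding qint_def
      proof (rule exI[of _ "int N * \<lfloor>x\<rfloor>"], rule exI[of _ 0], intro conjI)
        have "real N * of_int \<lfloor>x\<rfloor> \<le> real N * R" using x by (intro mult_left_mono) linarith+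
        then show "\<bar>real_of_int (int N * \<lfloor>x\<rfloor>) - real_of_int 0 * sqrt d\<bar> \<le> K"
          using K x by (simp add: abs_mult)
      qed auto
      then show ?case by (intro exI[of _ "of_int \<lfloor>x\<rfloor>"]) auto
    next
      case (Suc k)
      then obtain y where y: "y \<le> x" "x < y + 1 / 2 ^ k" "qint d N (K * 2 ^ k) y" by blast
      obtain w where w: "0 < w" "w \<le> 1 / 2 ^ Suc k" "1 \<le> C * 2 ^ Suc k * w" "qint d N (C * 2 ^ Suc k) w"
        using C(2)[of "Suc k"] by blast
      define j where "j = \<lfloor>(x - y) / w\<rfloor>"
      have j: "real_of_int j \<le> (x - y) / w" "(x - y) / w < of_int j + 1" "0 \<le> j"
        using y w by (auto simp: j_def)
      have "(x - y) / w \<le> (1 / 2 ^ k) / w" using y w by (intro divide_right_mono) auto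
      also have "\<dots> \<le> 2 * C" using w by (simp add: field_simps)
      finally have j2: "real_of_int j \<le> 2 * C" using j by simp
      have "\<bar>real_of_int j\<bar> * (C * 2 ^ Suc k) \<le> (2 * C) * (C * 2 ^ Suc k)"
        using j j2 C by (intro mult_right_mono) auto
      also have "\<dots> = (4 * C * C) * 2 ^ k" by simp
      also have "\<dots> \<le> K * 2 ^ k" using K by (intro mult_right_mono) auto
      finally have b: "K * 2 ^ k + \<bar>real_of_int j\<bar> * (C * 2 ^ Suc k) \<le> K * 2 ^ Suc k" by simp
      have "qint d N (K * 2 ^ Suc k) (y + j * w)"
        by (rule qint_mono[OF qint_add[OF y(3) qint_mult_int[OF w(4)]] b])
      moreover have "y + j * w \<le> x" "x < y + j * w + w" using j w by (auto simp: field_simps)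
      ultimately show ?case using w(2) by (intro exI[of _ "y + j * w"]) auto
    qed
  qed
qed

lemma qint_dense:
  obtains K where "K > 0"
    "\<And>\<delta> x. 0 < \<delta> \<Longrightarrow> \<delta> \<le> R \<Longrightarrow> 0 \<le> x \<Longrightarrow> x \<le> R \<Longrightarrow>
      \<exists>y\<le>x. x < y + \<delta> \<and> qint d N (K / \<delta>) y"
proof -
  obtain K where K: "K > 0"
    "\<And>(k::nat) x. 0 \<le> x \<Longrightarrow> x \<le> R \<Longrightarrow> \<exists>y\<le>x. x < y + 1 / 2 ^ k \<and> qint d N (K * 2 ^ k) y"
    using qint_dense_dyadic by metis
  \<comment> \<open>The least k with \<open>1 / 2 ^ k < \<delta>\<close> satisfies
    \<open>2 ^ k \<le> 2 / \<delta>\<close> when it is positive; when it is 0,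
    \<open>\<delta> \<le> R\<close> gives \<open>1 \<le> R / \<delta>\<close>.\<close>
  define K' where "K' = K * max 2 R"
  show thesis
  proof (rule that[of K'])
    show "K' > 0" using K unfolding K'_def by simp
    fix \<delta> x assume a: "0 < \<delta>" "\<delta> \<le> R" "0 \<le> x" "x \<le> R"
    have ex: "\<exists>k. 1 / 2 ^ k < \<delta>"
      using real_arch_pow_inv[OF a(1), of "1 / 2"] by (auto simp: power_one_over)
    define k where "k = (LEAST k. 1 / 2 ^ k < \<delta>)"
    have k: "1 / 2 ^ k < \<delta>" unfolding k_def using ex by (rule LeastI_ex)
    have "2 ^ k \<le> max 2 R / \<delta>"
    proof (cases k)
      case 0
      then show ?thesis using a by (simp add: field_simps)
    next
      case (Suc m)
      then have "\<not> 1 / 2 ^ m < \<delta>" unfolding k_def using not_less_Least lessI by metis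
      then have "2 ^ k \<le> 2 / \<delta>" using a Suc by (simp add: field_simps)
      also have "\<dots> \<le> max 2 R / \<delta>" using a by (intro divide_right_mono) auto
      finally show ?thesis .
    qed
    then have "K * 2 ^ k \<le> K * (max 2 R / \<delta>)" using K by (intro mult_left_mono) auto
    then have b: "K * 2 ^ k \<le> K' / \<delta>" by (simp add: K'_def)
    obtain y where "y \<le> x" "x < y + 1 / 2 ^ k" "qint d N (K * 2 ^ k) y" using K(2)[OF a(3,4)] by blast
    then show "\<exists>y\<le>x. x < y + \<delta> \<and> qint d N (K' / \<delta>) y"
      using qint_mono[OF _ b] k by (intro exI[of _ y]) auto
  qed
qed

end

lemma quadratic_common_denominator:
  assumes "finite A" "\<And>i. i \<in> A \<Longrightarrow> g i \<in> quadratic_field d"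
  obtains N B where "N > 0" "\<And>i. i \<in> A \<Longrightarrow> qint d N B (g i)"
proof -
  have "\<exists>N B. N > 0 \<and> (\<forall>i\<in>A. qint d N B (g i))"
    using assms
  proof (induction A rule: finite_induct)
    case empty
    then show ?case by (intro exI[of _ 1]) auto
  next
    case (insert x F)
    then obtain N B where NB: "N > 0" "\<forall>i\<in>F. qint d N B (g i)" by blast
    obtain a b where ab: "g x = a + b * sqrt d" "a \<in> \<rat>" "b \<in> \<rat>"
      using insert.prems[of x] unfolding quadratic_field_def by auto
    obtain p m :: int where p: "a = p / m" "m > 0" using ab(2) by (metis Rats_cases')
    obtain q n :: int where q: "b = q / n" "n > 0" using ab(3) by (metis Rats_cases')
    define M where "M = nat (m * n)"
    have M: "M > 0" "real M = m * n" using p q by (auto simp: M_def)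
    \<comment> \<open>Passing from the denominator \<open>N\<close> to \<open>N * M\<close>
      multiplies the conjugates by \<open>M\<close>.\<close>
    have scale: "qint d (N * M) (real M * B) z" if z: "qint d N B z" for z
    proof -
      obtain e f :: int where 1: "real N * z = e + f * sqrt d" "\<bar>e - f * sqrt d\<bar> \<le> B"
        using z unfolding qint_def by blast
      have "\<bar>real M * (e - f * sqrt d)\<bar> \<le> real M * B"
        unfolding abs_mult using 1 by (intro mult_mono) auto
      moreover have "real M * (real N * z) = real M * (e + f * sqrt d)" using 1 by simp
      ultimately show ?thesis
        unfolding qint_def
        by (intro exI[of _ "int M * e"] exI[of _ "int M * f"]) (simp add: algebra_simps)
    qed
    let ?a = "int N * p * n" and ?b = "int N * q * m"
    have "real (N * M) * g x = ?a + ?b * sqrt d"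
    proof -
      have "real_of_int p = a * m" "real_of_int q = b * n" using p q by auto
      then show ?thesis using M(2) ab(1) by (simp add: algebra_simps)
    qed
    then have gx: "qint d (N * M) \<bar>?a - ?b * sqrt d\<bar> (g x)" unfolding qint_def by blast
    let ?B = "max (real M * B) \<bar>?a - ?b * sqrt d\<bar>"
    have "\<forall>i\<in>insert x F. qint d (N * M) ?B (g i)"
    proof
      fix i assume "i \<in> insert x F"
      then consider "i = x" | "i \<in> F" by blast
      then show "qint d (N * M) ?B (g i)"
      proof cases
        case 1
        then show ?thesis using qint_mono[OF gx max.cobounded2] by simp
      next
        case 2
        then show ?thesis using NB qint_mono[OF scale max.cobounded1] by blast
      qed
    qed
    then show ?case using NB M by (intro exI[of _ "N * M"] exI[of _ ?B]) simp
  qed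
  then show thesis using that by blast
qed

section \<open>Interval exchanges\<close>

text \<open>The weights are arbitrary because two tilings of the domain are needed: by the exchanged
  intervals and, with the lengths permuted, by their images.\<close>

lemma subdivision_unique:
  fixes w :: "nat \<Rightarrow> real"
  assumes w: "\<And>i. i \<in> {1..n} \<Longrightarrow> 0 < w i" and z: "z \<in> {a..<a + sum w {1..n}}"
  shows "\<exists>!i. i \<in> {1..n} \<and> z \<in> {a + sum w {1..<i}..<a + sum w {1..<i} + w i}"
proof -
  have step: "a + sum w {1..<i} + w i = a + sum w {1..<Suc i}" if "i \<ge> 1" for i
    using that by simp
  have mono: "sum w {1..<Suc i} \<le> sum w {1..<j}" if "i < j" "j \<le> n" for i j
    by (rule sum_mono2) (use that w in \<open>auto intro: less_imp_le\<close>)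
  define i where "i = (LEAST i. z < a + sum w {1..<Suc i})"
  have ex: "z < a + sum w {1..<Suc n}" using z by (simp add: atLeastLessThanSuc_atLeastAtMost)
  have i: "z < a + sum w {1..<Suc i}" unfolding i_def using ex by (rule LeastI)
  have "i \<le> n" unfolding i_def using ex by (rule Least_le)
  have "i \<noteq> 0" using i z by (intro notI) simp
  then have i1: "i \<ge> 1" by simp
  have "\<not> z < a + sum w {1..<Suc (i - 1)}" unfolding i_def
    by (rule not_less_Least) (use \<open>i \<noteq> 0\<close> in \<open>simp add: i_def\<close>)
  then have lo: "a + sum w {1..<i} \<le> z" using \<open>i \<noteq> 0\<close> by simp
  show ?thesis
  proof (rule ex1I[of _ i])
    show "i \<in> {1..n} \<and> z \<in> {a + sum w {1..<i}..<a + sum w {1..<i} + w i}"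
      using i i1 \<open>i \<le> n\<close> lo step[OF i1] by auto
    fix j assume j: "j \<in> {1..n} \<and> z \<in> {a + sum w {1..<j}..<a + sum w {1..<j} + w j}"
    then have hj: "z < a + sum w {1..<Suc j}" "a + sum w {1..<j} \<le> z" using step[of j] by auto
    show "j = i"
    proof (rule linorder_cases[of i j])
      assume "i < j"
      then show ?thesis using mono[of i j] j hj i by auto
    next
      assume "j < i"
      then show ?thesis using mono[of j i] \<open>i \<le> n\<close> hj lo by auto
    qed simp
  qed
qed

locale exchange =
  fixes T :: iet
  assumes iet: "is_iet T"
begin

abbreviation "s \<equiv> iet_num T"
abbreviation "lft \<equiv> iet_left T"
abbreviation "rgt \<equiv> iet_right T"
abbreviation "\<Omega> \<equiv> iet_dom T"
abbreviation "\<Lambda> \<equiv> iet_len T"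
abbreviation "\<gamma> \<equiv> iet_gamma T"
abbreviation "\<delta> \<equiv> iet_delta T"
abbreviation "\<pi> \<equiv> iet_perm T"
abbreviation "f \<equiv> iet_map T"
abbreviation "P \<equiv> iet_pow T"

lemma s_pos: "1 \<le> s" and len_pos: "i \<in> {1..s} \<Longrightarrow> 0 < \<Lambda> i"
  and perm: "\<pi> permutes {1..s}"
  using iet unfolding is_iet_def by auto

lemma gamma_1: "\<gamma> (Suc 0) = lft"
  by (simp add: iet_gamma_def)

lemma gamma_Suc: "1 \<le> i \<Longrightarrow> \<gamma> (Suc i) = \<gamma> i + \<Lambda> i"
  by (simp add: iet_gamma_def)

lemma gamma_end: "\<gamma> (Suc s) = rgt"
  by (simp add: iet_gamma_def iet_right_def atLeastLessThanSuc_atLeastAtMost)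

lemma gamma_mono: "i < j \<Longrightarrow> 1 \<le> i \<Longrightarrow> j \<le> Suc s \<Longrightarrow> \<gamma> i + \<Lambda> i \<le> \<gamma> j"
proof -
  assume a: "i < j" "1 \<le> i" "j \<le> Suc s"
  have "sum \<Lambda> {1..<Suc i} \<le> sum \<Lambda> {1..<j}"
    by (rule sum_mono2) (use a len_pos in \<open>auto intro: less_imp_le\<close>)
  then show ?thesis using gamma_Suc[OF a(2)] by (simp add: iet_gamma_def)
qed

lemma gamma_less: "i < j \<Longrightarrow> 1 \<le> i \<Longrightarrow> j \<le> Suc s \<Longrightarrow> \<gamma> i < \<gamma> j"
  using gamma_mono[of i j] len_pos[of i] by force

lemma gamma_in_dom: "i \<in> {1..s} \<Longrightarrow> \<gamma> i \<in> \<Omega>"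
  using gamma_less[of 1 i] gamma_less[of i "Suc s"] gamma_1 gamma_end
  by (cases "i = 1") (auto simp: iet_dom_def)

lemma lft_less_rgt: "lft < rgt"
  using gamma_in_dom[of 1] s_pos by (simp add: iet_dom_def)

lemma interval_subset_dom: "i \<in> {1..s} \<Longrightarrow> iet_interval T i \<subseteq> \<Omega>"
  using gamma_in_dom[of i] gamma_mono[of i "Suc s"] gamma_end
  by (auto simp: iet_dom_def iet_interval_def)

lemma letter_unique:
  assumes "z \<in> \<Omega>"
  shows "\<exists>!i. i \<in> {1..s} \<and> z \<in> iet_interval T i"
  using subdivision_unique[of s \<Lambda> z lft] len_pos assms
  unfolding iet_interval_def iet_gamma_def iet_dom_def iet_right_def by simp

lemma letter:
  assumes "z \<in> \<Omega>"
  shows "iet_letter T z \<in> {1..s}" "z \<in> iet_interval T (iet_letter T z)"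
  using theI'[OF letter_unique[OF assms]] unfolding iet_letter_def by auto

lemma letter_eq:
  assumes "i \<in> {1..s}" "z \<in> iet_interval T i"
  shows "iet_letter T z = i"
  using letter[of z] letter_unique[of z] assms interval_subset_dom by blast

lemma map_on_interval:
  assumes "i \<in> {1..s}" "z \<in> iet_interval T i"
  shows "f z = z + (\<delta> i - \<gamma> i)"
  using assms letter_eq[OF assms] interval_subset_dom unfolding iet_map_def by fastforce

text \<open>Taken in the order of the images, the image positions are partial sums again, so
  \<open>subdivision_unique\<close> applies to them too.\<close>

lemma delta_eq:
  assumes "m \<in> {1..s}"
  shows "\<delta> (inv \<pi> m) = lft + (\<Sum>k\<in>{1..<m}. \<Lambda> (inv \<pi> k))"
proof -
  have "\<pi> (inv \<pi> m) = m" using perm by (simp add: permutes_inverses)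
  then have "\<delta> (inv \<pi> m) = lft + sum \<Lambda> {j \<in> {1..s}. \<pi> j < m}" by (simp add: iet_delta_def)
  also have "sum \<Lambda> {j \<in> {1..s}. \<pi> j < m} = (\<Sum>k\<in>{1..<m}. \<Lambda> (inv \<pi> k))"
  proof (rule sum.reindex_bij_witness[of _ "inv \<pi>" \<pi>])
    fix j assume "j \<in> {j \<in> {1..s}. \<pi> j < m}"
    then show "\<pi> j \<in> {1..<m}" using permutes_in_image[OF perm, of j] by auto
  next
    fix k assume "k \<in> {1..<m}"
    then show "inv \<pi> k \<in> {j \<in> {1..s}. \<pi> j < m}"
      using permutes_in_image[OF permutes_inv[OF perm], of k] assms perm by (auto simp: permutes_inverses)
  qed (use perm in \<open>auto simp: permutes_inverses\<close>)
  finally show ?thesis .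
qed

lemma image_unique:
  assumes "y \<in> \<Omega>"
  shows "\<exists>!i. i \<in> {1..s} \<and> y \<in> {\<delta> i..<\<delta> i + \<Lambda> i}"
proof -
  let ?w = "\<lambda>k. \<Lambda> (inv \<pi> k)"
  have inv_in: "inv \<pi> k \<in> {1..s} \<longleftrightarrow> k \<in> {1..s}" for k
    using permutes_in_image[OF permutes_inv[OF perm]] .
  have "sum ?w {1..s} = sum \<Lambda> {1..s}"
    by (rule sum.reindex_bij_betw[OF permutes_imp_bij[OF permutes_inv[OF perm]]])
  then have y: "y \<in> {lft..<lft + sum ?w {1..s}}" using assms by (simp add: iet_dom_def iet_right_def)
  have "\<exists>!k. k \<in> {1..s} \<and> y \<in> {lft + sum ?w {1..<k}..<lft + sum ?w {1..<k} + ?w k}"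
    by (rule subdivision_unique[OF _ y]) (use inv_in len_pos in blast)
  then have "\<exists>!k. k \<in> {1..s} \<and> y \<in> {\<delta> (inv \<pi> k)..<\<delta> (inv \<pi> k) + \<Lambda> (inv \<pi> k)}"
    using delta_eq by (metis (no_types, lifting))
  then show ?thesis
    using inv_in by (metis permutes_inverses(2)[OF perm] permutes_inverses(1)[OF perm])
qed

lemma delta_in_dom: "i \<in> {1..s} \<Longrightarrow> lft \<le> \<delta> i \<and> \<delta> i + \<Lambda> i \<le> rgt"
proof
  assume i: "i \<in> {1..s}"
  have "0 \<le> sum \<Lambda> {j \<in> {1..s}. \<pi> j < \<pi> i}" by (rule sum_nonneg) (use len_pos in \<open>auto intro: less_imp_le\<close>)
  then show "lft \<le> \<delta> i" by (simp add: iet_delta_def)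
  have "sum \<Lambda> (insert i {j \<in> {1..s}. \<pi> j < \<pi> i}) \<le> sum \<Lambda> {1..s}"
    by (rule sum_mono2) (use i len_pos in \<open>auto intro: less_imp_le\<close>)
  then show "\<delta> i + \<Lambda> i \<le> rgt" by (simp add: iet_delta_def iet_right_def)
qed

lemma map_in_dom: "z \<in> \<Omega> \<Longrightarrow> f z \<in> \<Omega>"
  using letter[of z] map_on_interval[of "iet_letter T z" z] delta_in_dom[of "iet_letter T z"]
  by (auto simp: iet_interval_def iet_dom_def)

lemma map_inj_on: "inj_on f \<Omega>"
proof (rule inj_onI)
  fix x y assume xy: "x \<in> \<Omega>" "y \<in> \<Omega>" "f x = f y"
  have *: "f z \<in> {\<delta> (iet_letter T z)..<\<delta> (iet_letter T z) + \<Lambda> (iet_letter T z)}" if "z \<in> \<Omega>" for z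
    using letter[OF that] map_on_interval[of "iet_letter T z" z] by (auto simp: iet_interval_def)
  have "iet_letter T x = iet_letter T y"
    using image_unique[OF map_in_dom[OF xy(1)]] *[OF xy(1)] *[OF xy(2)] letter(1) xy by metis
  then show "x = y" using map_on_interval letter xy by (metis add_right_cancel)
qed

lemma map_onto: "f ` \<Omega> = \<Omega>"
proof
  show "f ` \<Omega> \<subseteq> \<Omega>" using map_in_dom by blast
  show "\<Omega> \<subseteq> f ` \<Omega>"
  proof
    fix y assume "y \<in> \<Omega>"
    then obtain i where i: "i \<in> {1..s}" "y \<in> {\<delta> i..<\<delta> i + \<Lambda> i}" using image_unique by blast
    then have z: "y - (\<delta> i - \<gamma> i) \<in> iet_interval T i" by (auto simp: iet_interval_def)
    then have "f (y - (\<delta> i - \<gamma> i)) = y" using map_on_interval[OF i(1)] by simp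
    then show "y \<in> f ` \<Omega>" using z interval_subset_dom[OF i(1)] by force
  qed
qed

lemma map_in_dom_iff: "f z \<in> \<Omega> \<longleftrightarrow> z \<in> \<Omega>"
  using map_in_dom by (auto simp: iet_map_def split: if_splits)

lemma map_bij: "bij f"
proof (rule bijI)
  show "inj f"
  proof (rule injI)
    fix x y assume "f x = f y"
    then show "x = y" using map_inj_on map_in_dom_iff by (metis iet_map_def inj_onD)
  qed
  show "surj f"
    unfolding surj_def by (metis iet_map_def map_onto imageE)
qed

section \<open>Integer iterates\<close>

lemma pow_0 [simp]: "P 0 z = z"
  by (simp add: iet_pow_def)

lemma pow_nat: "P (int n) z = (f ^^ n) z"
  by (simp add: iet_pow_def)

lemma pow_Suc: "P (n + 1) z = f (P n z)"
proof -
  consider "n \<ge> 0" | "n = -1" | "n < -1" by linarith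
  then show ?thesis
  proof cases
    case 1
    then show ?thesis by (simp add: iet_pow_def nat_add_distrib)
  next
    case 2
    then show ?thesis using bij_is_surj[OF map_bij] by (simp add: iet_pow_def surj_f_inv_f)
  next
    case 3
    then have "nat (- n) = Suc (nat (- (n + 1)))" by linarith
    then show ?thesis using 3 bij_is_surj[OF map_bij] by (simp add: iet_pow_def surj_f_inv_f)
  qed
qed

lemma pow_add: "P (m + n) z = P m (P n z)"
proof (induction m rule: int_induct[of _ 0])
  case base
  then show ?case by simp
next
  case (step1 i)
  then show ?case using pow_Suc[of "i + n" z] pow_Suc[of i "P n z"] by (simp add: add_ac)
next
  case (step2 i)
  then have "f (P (i - 1 + n) z) = f (P (i - 1) (P n z))"
    using pow_Suc[of "i - 1 + n" z] pow_Suc[of "i - 1" "P n z"] by (simp add: add_ac)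
  then show ?case using bij_is_inj[OF map_bij] by (simp add: inj_eq)
qed

lemma pow_inverse [simp]: "P (- n) (P n z) = z" "P n (P (- n) z) = z"
  by (simp_all flip: pow_add)

lemma pow_inj: "P n x = P n y \<Longrightarrow> x = y"
  by (metis pow_inverse(1))

lemma pow_in_dom_iff [simp]: "P n z \<in> \<Omega> \<longleftrightarrow> z \<in> \<Omega>"
proof (induction n rule: int_induct[of _ 0])
  case (step1 i)
  then show ?case using pow_Suc[of i z] map_in_dom_iff by simp
next
  case (step2 i)
  then show ?case using pow_Suc[of "i - 1" z] map_in_dom_iff by simp
qed simp

lemma pow_1: "P 1 z = f z"
  using pow_Suc[of 0 z] by simp

lemma iter_in_dom [simp]: "(f ^^ n) z \<in> \<Omega> \<longleftrightarrow> z \<in> \<Omega>"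
  using pow_in_dom_iff[of "int n" z] by (simp add: pow_nat)

lemma iter_inj: "(f ^^ n) x = (f ^^ n) y \<Longrightarrow> x = y"
  using pow_inj[of "int n"] by (simp add: pow_nat)

section \<open>Translation on intervals free of separation points\<close>

lemma map_translation:
  assumes "p \<in> \<Omega>" "x \<in> \<Omega>" "p \<le> x" "\<And>i. i \<in> {2..s} \<Longrightarrow> \<gamma> i \<notin> {p<..x}"
  shows "f x = x + (f p - p)"
proof -
  let ?b = "iet_letter T x"
  note b = letter[OF assms(2)]
  have "\<gamma> ?b \<le> p"
  proof (cases "?b = 1")
    case True
    then show ?thesis using gamma_1 assms(1) by (simp add: iet_dom_def)
  next
    case False
    then have "?b \<in> {2..s}" using b by auto
    then show ?thesis using assms(4)[of ?b] b by (auto simp: iet_interval_def)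
  qed
  then have "p \<in> iet_interval T ?b" using b assms(3) by (auto simp: iet_interval_def)
  then show ?thesis using map_on_interval b by (metis add_diff_cancel_left')
qed

text \<open>Only interior points have to avoid the separation points: the exchanged intervals are
  closed on the left, so an iterate of the left end may sit on one. A separation point that cuts the
  n-th image pulls back, along the translation already known, to an interior point of [p,
  q[.\<close>

lemma iter_translation:
  assumes "p \<in> \<Omega>" "q \<le> rgt" "\<And>y k i. y \<in> {p<..<q} \<Longrightarrow> k < n \<Longrightarrow> i \<in> {2..s} \<Longrightarrow> (f ^^ k) y \<noteq> \<gamma> i"
    and "x \<in> {p..<q}"
  shows "(f ^^ n) x = x + ((f ^^ n) p - p)"
  using assms(3,4)
proof (induction n arbitrary: x)
  case (Suc n)
  let ?t = "(f ^^ n) p - p"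
  have IH: "(f ^^ n) y = y + ?t" if "y \<in> {p..<q}" for y
    by (rule Suc.IH[OF _ that]) (use Suc.prems(1) in auto)
  have dom: "y \<in> \<Omega>" if "y \<in> {p..<q}" for y using that assms(1,2) by (auto simp: iet_dom_def)
  have "f ((f ^^ n) x) = (f ^^ n) x + (f ((f ^^ n) p) - (f ^^ n) p)"
  proof (rule map_translation)
    show "(f ^^ n) p \<in> \<Omega>" "(f ^^ n) x \<in> \<Omega>" using assms(1) dom Suc.prems by auto
    show "(f ^^ n) p \<le> (f ^^ n) x" using IH[OF Suc.prems(2)] Suc.prems(2) by auto
    fix i assume i: "i \<in> {2..s}"
    show "\<gamma> i \<notin> {(f ^^ n) p<..(f ^^ n) x}"
    proof
      assume a: "\<gamma> i \<in> {(f ^^ n) p<..(f ^^ n) x}"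
      have "\<gamma> i - ?t \<in> {p<..<q}" using a IH[OF Suc.prems(2)] Suc.prems(2) by auto
      moreover from this have "(f ^^ n) (\<gamma> i - ?t) = \<gamma> i" using IH[of "\<gamma> i - ?t"] by auto
      ultimately show False using Suc.prems(1)[of "\<gamma> i - ?t" n i] i by auto
    qed
  qed
  then show ?case using IH[OF Suc.prems(2)] by simp
qed auto

end

section \<open>Orbit cells and recurrence\<close>

lemma lmeasurable_semi_interval: "{a..<b::real} \<in> lmeasurable"
  by (rule fmeasurableI2[of "{a..b}"]) auto

lemma semi_interval_packing:
  fixes a b :: "'i \<Rightarrow> real"
  assumes "finite K" "\<And>i. i \<in> K \<Longrightarrow> a i \<le> b i" "\<And>i. i \<in> K \<Longrightarrow> {a i..<b i} \<subseteq> {l..<r}"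
    "\<And>i j. i \<in> K \<Longrightarrow> j \<in> K \<Longrightarrow> i \<noteq> j \<Longrightarrow> {a i..<b i} \<inter> {a j..<b j} = {}" "l \<le> r"
  shows "(\<Sum>i\<in>K. b i - a i) \<le> r - l"
proof -
  have "(\<Sum>i\<in>K. b i - a i) = (\<Sum>i\<in>K. measure lebesgue {a i..<b i})"
    by (intro sum.cong) (use assms(2) in auto)
  also have "\<dots> = measure lebesgue (\<Union>i\<in>K. {a i..<b i})"
    by (rule measure_UNION'[symmetric])
      (use assms in \<open>auto simp: pairwise_def disjnt_def lmeasurable_semi_interval\<close>)
  also have "\<dots> \<le> measure lebesgue {l..<r}"
  proof (rule measure_mono_fmeasurable)
    show "(\<Union>i\<in>K. {a i..<b i}) \<subseteq> {l..<r}" using assms(3) by blast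
    show "(\<Union>i\<in>K. {a i..<b i}) \<in> sets lebesgue"
      by (intro fmeasurableD fmeasurable.finite_UN assms(1) lmeasurable_semi_interval)
  qed (rule lmeasurable_semi_interval)
  also have "\<dots> = r - l" using assms(5) by simp
  finally show ?thesis .
qed

context exchange
begin

lemma dom_interval: "\<Omega> = {lft..<rgt}"
  by (simp add: iet_dom_def)

section \<open>Measure preservation and recurrence\<close>

lemma measure_image:
  assumes "A \<in> lmeasurable" "A \<subseteq> \<Omega>"
  shows "f ` A \<in> lmeasurable \<and> measure lebesgue (f ` A) = measure lebesgue A"
proof -
  let ?A = "\<lambda>i. A \<inter> iet_interval T i"
  have A: "A = (\<Union>i\<in>{1..s}. ?A i)" using assms(2) letter by blast
  have Am: "?A i \<in> lmeasurable" for i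
    unfolding iet_interval_def by (intro fmeasurable.Int assms(1) lmeasurable_semi_interval)
  have im: "f ` ?A i = (+) (\<delta> i - \<gamma> i) ` ?A i" if "i \<in> {1..s}" for i
    by (rule image_cong) (use map_on_interval[OF that] in auto)
  have fm: "f ` ?A i \<in> lmeasurable" "measure lebesgue (f ` ?A i) = measure lebesgue (?A i)"
    if "i \<in> {1..s}" for i
    unfolding im[OF that] by (simp_all add: measurable_translation Am measure_translation)
  have dis: "?A i \<inter> ?A j = {}" if "i \<in> {1..s}" "j \<in> {1..s}" "i \<noteq> j" for i j
    using that letter_eq by blast
  have fA: "f ` A = (\<Union>i\<in>{1..s}. f ` ?A i)" using A by (metis image_UN)
  have m: "f ` A \<in> lmeasurable" unfolding fA by (rule fmeasurable.finite_UN) (use fm in auto)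
  have "measure lebesgue (f ` A) = (\<Sum>i\<in>{1..s}. measure lebesgue (f ` ?A i))"
    unfolding fA
  proof (rule measure_UNION')
    have "f ` ?A i \<inter> f ` ?A j = {}" if "i \<in> {1..s}" "j \<in> {1..s}" "i \<noteq> j" for i j
      using dis[OF that] image_Int[OF bij_is_inj[OF map_bij], of "?A i" "?A j"] by simp
    then show "pairwise (\<lambda>i j. disjnt (f ` ?A i) (f ` ?A j)) {1..s}"
      unfolding pairwise_def disjnt_def by blast
  qed (use fm in auto)
  also have "\<dots> = (\<Sum>i\<in>{1..s}. measure lebesgue (?A i))" using fm by simp
  also have "\<dots> = measure lebesgue (\<Union>i\<in>{1..s}. ?A i)"
    by (rule measure_UNION'[symmetric]) (use Am dis in \<open>auto simp: pairwise_def disjnt_def\<close>)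
  also have "\<dots> = measure lebesgue A" using A by simp
  finally show ?thesis using m by auto
qed

lemma measure_iter_image:
  assumes "A \<in> lmeasurable" "A \<subseteq> \<Omega>"
  shows "(f ^^ n) ` A \<in> lmeasurable \<and> measure lebesgue ((f ^^ n) ` A) = measure lebesgue A"
proof (induction n)
  case (Suc n)
  have e: "(f ^^ Suc n) ` A = f ` ((f ^^ n) ` A)" by (simp add: image_comp)
  have "(f ^^ n) ` A \<subseteq> \<Omega>" using assms(2) by auto
  then show ?case unfolding e using measure_image Suc by metis
qed (use assms in simp)

text \<open>Without a return the iterated images of [a, b[ would be pairwise disjoint sets of equal
  positive measure, too many of them for the domain.\<close>

lemma poincare_recurrence:
  assumes "a < b" "{a..<b} \<subseteq> \<Omega>"
  shows "\<exists>n\<ge>1. \<exists>z\<in>{a..<b}. (f ^^ n) z \<in> {a..<b}"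
proof (rule ccontr)
  assume "\<not> ?thesis"
  then have no: "(f ^^ n) z \<notin> {a..<b}" if "n \<ge> 1" "z \<in> {a..<b}" for n z using that by blast
  let ?A = "\<lambda>n. (f ^^ n) ` {a..<b}"
  have sh: "?A m \<inter> ?A n = {}" if "m < n" for m n
  proof -
    have False if xy: "x \<in> {a..<b}" "y \<in> {a..<b}" "(f ^^ m) x = (f ^^ n) y" for x y
    proof -
      have "(f ^^ m) x = (f ^^ m) ((f ^^ (n - m)) y)"
        using xy(3) \<open>m < n\<close> by (metis add_diff_inverse_nat comp_apply funpow_add less_imp_not_less)
      then have "x = (f ^^ (n - m)) y" by (rule iter_inj)
      moreover have "n - m \<ge> 1" using \<open>m < n\<close> by simp
      ultimately show False using no[of "n - m" y] xy(1,2) by metis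
    qed
    then show ?thesis by blast
  qed
  obtain N :: nat where N: "real N * (b - a) > rgt - lft"
    using reals_Archimedean3[of "b - a"] assms(1) by auto
  have mA: "?A n \<in> lmeasurable" "measure lebesgue (?A n) = b - a" for n
    using measure_iter_image[OF lmeasurable_semi_interval assms(2), of n] assms(1) by auto
  have "real N * (b - a) = (\<Sum>n<N. measure lebesgue (?A n))" by (simp add: mA)
  also have "\<dots> = measure lebesgue (\<Union>n<N. ?A n)"
  proof (rule measure_UNION'[symmetric])
    have "?A m \<inter> ?A n = {}" if "m \<noteq> n" for m n
      using sh[of m n] sh[of n m] that by (metis Int_commute nat_neq_iff)
    then show "pairwise (\<lambda>m n. disjnt (?A m) (?A n)) {..<N}"
      unfolding pairwise_def disjnt_def by blast
  qed (use mA in auto)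
  also have "\<dots> \<le> measure lebesgue {lft..<rgt}"
  proof (rule measure_mono_fmeasurable)
    show "(\<Union>n<N. ?A n) \<subseteq> {lft..<rgt}" using assms(2) unfolding dom_interval[symmetric] by auto
    show "(\<Union>n<N. ?A n) \<in> sets lebesgue"
      by (intro fmeasurableD fmeasurable.finite_UN) (use mA in auto)
  qed (rule lmeasurable_semi_interval)
  also have "\<dots> = rgt - lft" using lft_less_rgt by simp
  finally show False using N by simp
qed

section \<open>Cells cut out by preimages of marked points\<close>

definition preimages :: "nat \<Rightarrow> real set \<Rightarrow> real set" where
  "preimages n C = {y \<in> \<Omega>. \<exists>k\<le>n. (f ^^ k) y \<in> C}"

lemma finite_preimages:
  assumes "finite C"
  shows "finite (preimages n C)"
proof -
  have "preimages n C \<subseteq> (\<lambda>(k, c). P (- int k) c) ` ({..n} \<times> C)"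
  proof
    fix y assume "y \<in> preimages n C"
    then obtain k where k: "k \<le> n" "(f ^^ k) y \<in> C" unfolding preimages_def by blast
    then show "y \<in> (\<lambda>(k, c). P (- int k) c) ` ({..n} \<times> C)"
      by (intro image_eqI[where x = "(k, (f ^^ k) y)"]) (auto simp flip: pow_nat)
  qed
  then show ?thesis by (rule finite_subset) (use assms in auto)
qed

lemma cell:
  assumes "finite Q" "Q \<subseteq> \<Omega>" "lft \<in> Q" "z \<in> \<Omega>"
  obtains p q where "p \<in> Q" "p \<le> z" "z < q" "q \<in> Q \<or> q = rgt" "q \<le> rgt" "{p<..<q} \<inter> Q = {}"
proof -
  define p where "p = Max {y \<in> Q. y \<le> z}"
  define q where "q = Min (insert rgt {y \<in> Q. z < y})"
  have "{y \<in> Q. y \<le> z} \<noteq> {}" using assms by (auto simp: iet_dom_def)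
  then have p: "p \<in> Q" "p \<le> z" "\<And>y. y \<in> Q \<Longrightarrow> y \<le> z \<Longrightarrow> y \<le> p"
    unfolding p_def using Max_in[of "{y \<in> Q. y \<le> z}"] Max_ge[of "{y \<in> Q. y \<le> z}"] assms(1) by auto
  have q: "q \<in> insert rgt {y \<in> Q. z < y}" unfolding q_def by (rule Min_in) (use assms in auto)
  have q_le: "q \<le> y" if "y \<in> insert rgt {y \<in> Q. z < y}" for y unfolding q_def
    by (rule Min_le) (use assms that in auto)
  show thesis
  proof (rule that[OF p(1,2)])
    show "z < q" "q \<in> Q \<or> q = rgt" using q assms(4) by (auto simp: iet_dom_def)
    show "q \<le> rgt" by (rule q_le) simp
    show "{p<..<q} \<inter> Q = {}"
    proof (rule ccontr)
      assume "{p<..<q} \<inter> Q \<noteq> {}"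
      then obtain y where y: "p < y" "y < q" "y \<in> Q" by auto
      then show False using p(3)[of y] q_le[of y] by (cases "y \<le> z") auto
    qed
  qed
qed

text \<open>The cell lies between consecutive points of the finite set of preimages, so the first n
  iterates move it rigidly. The marked points include \<open>\<gamma> 1\<close>, the left end of the
  domain, so every point has a cell. That the ends are preimages or \<open>rgt\<close> will control
  the conjugate of its length.\<close>

lemma translation_cell:
  assumes "finite C" "z \<in> \<Omega>"
  obtains p q where "p \<in> preimages n (\<gamma> ` {1..s} \<union> C)" "p \<le> z" "z < q"
    "q \<in> preimages n (\<gamma> ` {1..s} \<union> C) \<or> q = rgt" "q \<le> rgt"
    "{p..<q} \<subseteq> \<Omega>"
    "\<forall>y\<in>{p..<q}. \<forall>k\<le>n. (f ^^ k) y = y + ((f ^^ k) p - p)"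
    "\<forall>y\<in>{p<..<q}. \<forall>k\<le>n. (f ^^ k) y \<notin> \<gamma> ` {1..s} \<union> C"
proof -
  let ?Q = "preimages n (\<gamma> ` {1..s} \<union> C)"
  have fin: "finite ?Q" by (intro finite_preimages) (use assms in auto)
  have lft: "lft \<in> ?Q" using gamma_in_dom[of 1] s_pos gamma_1 unfolding preimages_def
    by (auto intro!: exI[of _ 0] image_eqI[of _ _ 1])
  have sub: "?Q \<subseteq> \<Omega>" by (auto simp: preimages_def)
  obtain p q where pq: "p \<in> ?Q" "p \<le> z" "z < q" "q \<in> ?Q \<or> q = rgt" "q \<le> rgt" "{p<..<q} \<inter> ?Q = {}"
    by (rule cell[OF fin sub lft assms(2)])
  have p: "p \<in> \<Omega>" using pq(1) by (simp add: preimages_def)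
  have sub: "{p..<q} \<subseteq> \<Omega>" using p pq(5) by (auto simp: iet_dom_def)
  have avoid: "(f ^^ k) y \<notin> \<gamma> ` {1..s} \<union> C" if "y \<in> {p<..<q}" "k \<le> n" for y k
  proof -
    have "y \<notin> ?Q" "y \<in> \<Omega>" using that pq(6) sub by (auto simp: subset_iff)
    then show ?thesis using that(2) unfolding preimages_def by blast
  qed
  have tr: "(f ^^ k) y = y + ((f ^^ k) p - p)" if "y \<in> {p..<q}" "k \<le> n" for y k
  proof (rule iter_translation[OF p pq(5) _ that(1)])
    fix y' k' i assume "y' \<in> {p<..<q}" "k' < k" "i \<in> {2..s}"
    then show "(f ^^ k') y' \<noteq> \<gamma> i" using avoid[of y' k'] that(2) by auto
  qed
  show thesis by (rule that[OF pq(1-5) sub]) (use tr avoid in blast)+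
qed

text \<open>The image of the cell is an interval; to lie only partly in [a, b[ it would need a or b
  in its interior.\<close>

lemma cell_membership:
  assumes "\<And>y. y \<in> {p..<q} \<Longrightarrow> g y = y + (g p - p)" "\<And>y. y \<in> {p<..<q} \<Longrightarrow> g y \<notin> {a, b}"
    "y \<in> {p..<q}" "z \<in> {p..<q}"
  shows "g y \<in> {a..<b} \<longleftrightarrow> g z \<in> {a..<b::real}"
proof -
  have *: "g y \<in> {a..<b}" if yz: "y \<in> {p..<q}" "z \<in> {p..<q}" "g z \<in> {a..<b}" for y z
  proof (rule ccontr)
    assume n: "g y \<notin> {a..<b}"
    define c where "c = g p - p"
    have g: "g w = w + c" if "w \<in> {p..<q}" for w using assms(1)[OF that] c_def by simp
    consider "g y < a" | "b \<le> g y" using n by fastforce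
    then show False
    proof cases
      case 1
      then have "a - c \<in> {p<..<q}" using g yz by auto
      then show False using assms(2)[of "a - c"] g[of "a - c"] by auto
    next
      case 2
      then have "b - c \<in> {p<..<q}" using g yz by auto
      then show False using assms(2)[of "b - c"] g[of "b - c"] by auto
    qed
  qed
  show ?thesis using *[OF assms(3,4)] *[OF assms(4,3)] by blast
qed

definition avoiding :: "real set \<Rightarrow> nat \<Rightarrow> real set" where
  "avoiding J n = {z \<in> \<Omega>. \<forall>k<n. (f ^^ k) z \<notin> J}"

end

section \<open>Regular interval exchanges\<close>

locale regular_exchange = exchange +
  assumes infinite_orbits: "\<And>i. i \<in> {2..s} \<Longrightarrow> infinite (iet_orbit T (\<gamma> i))"
    and disjoint_orbits: "\<And>i j. i \<in> {2..s} \<Longrightarrow> j \<in> {2..s} \<Longrightarrow> i \<noteq> j \<Longrightarrow>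
      iet_orbit T (\<gamma> i) \<inter> iet_orbit T (\<gamma> j) = {}"
    and s_ge_2: "2 \<le> s"
begin

section \<open>Orbits of the separation points\<close>

lemma gamma_not_periodic:
  assumes "i \<in> {2..s}" "n \<noteq> 0"
  shows "P n (\<gamma> i) \<noteq> \<gamma> i"
proof
  assume per: "P n (\<gamma> i) = \<gamma> i"
  have mult: "P (k * n) (\<gamma> i) = \<gamma> i" for k :: int
  proof (induction k rule: int_induct[of _ 0])
    case (step1 k)
    then show ?case using pow_add[of "k * n" n "\<gamma> i"] per by (simp add: algebra_simps)
  next
    case (step2 k)
    have "P ((k - 1) * n) (P n (\<gamma> i)) = P (k * n) (\<gamma> i)"
      unfolding pow_add[symmetric] by (simp add: algebra_simps)
    then show ?case using step2 per by simp
  qed simp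
  have "iet_orbit T (\<gamma> i) \<subseteq> (\<lambda>k. P k (\<gamma> i)) ` {-\<bar>n\<bar>..\<bar>n\<bar>}"
  proof
    fix y assume "y \<in> iet_orbit T (\<gamma> i)"
    then obtain m where m: "y = P m (\<gamma> i)" unfolding iet_orbit_def by blast
    have "P m (\<gamma> i) = P (m mod n + (m div n) * n) (\<gamma> i)" by simp
    also have "\<dots> = P (m mod n) (\<gamma> i)" unfolding pow_add[of "m mod n"] mult ..
    finally have "y = P (m mod n) (\<gamma> i)" using m by simp
    moreover have "m mod n \<in> {-\<bar>n\<bar>..\<bar>n\<bar>}"
      using abs_mod_less[OF assms(2), of m] by auto
    ultimately show "y \<in> (\<lambda>k. P k (\<gamma> i)) ` {-\<bar>n\<bar>..\<bar>n\<bar>}" by blast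
  qed
  then show False using infinite_orbits[OF assms(1)] finite_subset by blast
qed

lemma orbit_separation:
  assumes "i \<in> {2..s}" "j \<in> {2..s}" "P m (\<gamma> i) = P n (\<gamma> j)"
  shows "i = j" "m = n"
proof -
  have "P m (\<gamma> i) \<in> iet_orbit T (\<gamma> i) \<inter> iet_orbit T (\<gamma> j)"
    using assms(3) unfolding iet_orbit_def by blast
  then show ij: "i = j" using disjoint_orbits assms by blast
  have "P (- n) (P m (\<gamma> i)) = \<gamma> i" using assms(3) ij by simp
  then have "P (- n + m) (\<gamma> i) = \<gamma> i" by (simp only: pow_add)
  then show "m = n" using gamma_not_periodic[OF assms(1), of "- n + m"] by force
qed

text \<open>If letter 1 also came first in the image, the second interval of the image would begin
  at \<open>\<gamma> 2\<close>, and \<open>f\<close> would map a separation point to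
  \<open>\<gamma> 2\<close>. The lemma serves to replace \<open>\<gamma> 1\<close>, whose orbit the
  definition of regularity does not mention, by a separation point of index at least 2.\<close>

lemma left_end_preimage:
  obtains j where "j \<in> {2..s}" "f (\<gamma> j) = lft"
proof -
  have f_gamma: "f (\<gamma> i) = \<delta> i" if "i \<in> {1..s}" for i
    using map_on_interval[OF that, of "\<gamma> i"] len_pos[OF that] by (simp add: iet_interval_def)
  have inv_in: "inv \<pi> k \<in> {1..s} \<longleftrightarrow> k \<in> {1..s}" for k
    using permutes_in_image[OF permutes_inv[OF perm]] .
  have j: "inv \<pi> 1 \<in> {1..s}" "f (\<gamma> (inv \<pi> 1)) = lft"
    using inv_in[of 1] s_pos f_gamma[of "inv \<pi> 1"] delta_eq[of 1] by auto
  have "inv \<pi> 1 \<noteq> 1"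
  proof
    assume 1: "inv \<pi> 1 = 1"
    let ?k = "inv \<pi> 2"
    have "?k \<in> {1..s}" using inv_in[of 2] s_ge_2 by simp
    moreover have "?k \<noteq> 1" using 1 permutes_inverses(1)[OF perm] by (metis one_eq_numeral_iff semiring_norm(85))
    ultimately have k: "?k \<in> {2..s}" by auto
    have "f (\<gamma> ?k) = lft + \<Lambda> 1"
      using f_gamma[of ?k] delta_eq[of 2] s_ge_2 k 1 by (simp add: numeral_2_eq_2)
    also have "\<dots> = \<gamma> 2" using gamma_Suc[of 1] gamma_1 by (simp add: numeral_2_eq_2)
    finally have "P 1 (\<gamma> ?k) = P 0 (\<gamma> 2)" by (simp add: pow_1)
    then show False using orbit_separation(2)[OF k, of 2 1 0] s_ge_2 by simp
  qed
  then show thesis using that[of "inv \<pi> 1"] j by auto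
qed

text \<open>For \<open>i = 1\<close> the orbit is prolonged backwards by one step to a separation
  point of index at least 2.\<close>

lemma no_connection:
  assumes "i \<in> {1..s}" "j \<in> {2..s}" "n \<ge> 1"
  shows "P n (\<gamma> i) \<noteq> \<gamma> j"
proof
  assume e: "P n (\<gamma> i) = \<gamma> j"
  show False
  proof (cases "i = 1")
    case True
    obtain k where k: "k \<in> {2..s}" "f (\<gamma> k) = lft" by (rule left_end_preimage)
    have "P (n + 1) (\<gamma> k) = P 0 (\<gamma> j)" using e k True gamma_1 by (simp add: pow_add pow_1)
    then show False using orbit_separation(2)[OF k(1) assms(2), of "n + 1" 0] assms(3) by simp
  next
    case False
    then have "i \<in> {2..s}" using assms by auto
    then show False using orbit_separation(2)[of i j n 0] e assms by simp
  qed
qed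

text \<open>On a cell the n-th iterate is a translation, trivial as soon as one point is fixed. Then
  the left end of the cell is periodic too, and its orbit meets a separation point.\<close>

lemma aperiodic:
  assumes "x \<in> \<Omega>" "n \<ge> 1"
  shows "(f ^^ n) x \<noteq> x"
proof
  assume per: "(f ^^ n) x = x"
  obtain p q where p: "p \<in> preimages n (\<gamma> ` {1..s} \<union> {})" "p \<le> x" "x < q"
    "\<forall>y\<in>{p..<q}. \<forall>k\<le>n. (f ^^ k) y = y + ((f ^^ k) p - p)"
    by (rule translation_cell[OF finite.emptyI assms(1)])
  have "x \<in> {p..<q}" using p(2,3) by simp
  then have "(f ^^ n) x = x + ((f ^^ n) p - p)" using p(4) by blast
  then have "(f ^^ n) p = p" using per by simp
  moreover obtain k i where ki: "(f ^^ k) p = \<gamma> i" "i \<in> {1..s}" using p(1) unfolding preimages_def by auto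
  ultimately have "P (int n) (P (int k) p) = P (int k) p"
    by (metis pow_add add.commute pow_nat)
  then have gi: "P (int n) (\<gamma> i) = \<gamma> i" using ki by (simp add: pow_nat)
  show False
  proof (cases "i = 1")
    case True
    obtain j where j: "j \<in> {2..s}" "f (\<gamma> j) = lft" by (rule left_end_preimage)
    have "P (int n + 1) (\<gamma> j) = P 1 (\<gamma> j)" using gi True j gamma_1 by (simp add: pow_add pow_1)
    then show False using orbit_separation(2)[OF j(1) j(1)] assms(2) by fastforce
  next
    case False
    then show False using gamma_not_periodic[of i "int n"] gi ki assms by auto
  qed
qed

text \<open>
  Keane's minimality argument. A set \<open>G\<close> of points that avoid \<open>[a, b[\<close> forever would be
  invariant, by Poincare recurrence. The finitely many points at which its indicator jumps are
  carried to each other by \<open>T\<close> and its inverse until a separation point is met, so some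
  separation point is mapped to another one.
\<close>

lemma avoiding_strict:
  assumes J: "a < b" "{a..<b} \<subseteq> \<Omega>" and ne: "avoiding {a..<b} t \<noteq> {}"
  shows "avoiding {a..<b} t \<noteq> avoiding {a..<b} (Suc t)"
proof
  define G where "G = avoiding {a..<b} t"
  assume "avoiding {a..<b} t = avoiding {a..<b} (Suc t)"
  then have G_Suc: "G = avoiding {a..<b} (Suc t)" by (simp add: G_def)
  have G_dom: "G \<subseteq> \<Omega>" by (auto simp: G_def avoiding_def)
  let ?C = "{a, b}"
  let ?Q = "preimages (Suc t) (\<gamma> ` {1..s} \<union> ?C)"
  \<comment> \<open>Enough iterates are followed for membership in \<open>G\<close> of both y and
    \<open>f y\<close> to be constant on the cell.\<close>
  have cells: "\<exists>p q. p \<in> ?Q \<and> p \<le> z \<and> z < q \<and> {p..<q} \<subseteq> \<Omega> \<and>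
      (\<forall>y\<in>{p..<q}. (y \<in> G \<longleftrightarrow> z \<in> G) \<and> (f y \<in> G \<longleftrightarrow> f z \<in> G))"
    if z: "z \<in> \<Omega>" for z
  proof -
    have finC: "finite ?C" by simp
    obtain p q where p: "p \<in> ?Q" "p \<le> z" "z < q" "q \<in> ?Q \<or> q = rgt" "q \<le> rgt"
      "{p..<q} \<subseteq> \<Omega>"
      "\<forall>y\<in>{p..<q}. \<forall>k\<le>Suc t. (f ^^ k) y = y + ((f ^^ k) p - p)"
      "\<forall>y\<in>{p<..<q}. \<forall>k\<le>Suc t. (f ^^ k) y \<notin> \<gamma> ` {1..s} \<union> ?C"
      by (rule translation_cell[OF finC z])
    have J_iff: "(f ^^ k) y \<in> {a..<b} \<longleftrightarrow> (f ^^ k) z \<in> {a..<b}" if "y \<in> {p..<q}" "k \<le> Suc t" for y k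
    proof (rule cell_membership[where p = p and q = q and g = "f ^^ k"])
      show "(f ^^ k) w = w + ((f ^^ k) p - p)" if "w \<in> {p..<q}" for w
        using p(7) that \<open>k \<le> Suc t\<close> by blast
      show "(f ^^ k) w \<notin> {a, b}" if "w \<in> {p<..<q}" for w
        using p(8) that \<open>k \<le> Suc t\<close> by blast
    qed (use that p(2,3) in auto)
    have "(y \<in> G \<longleftrightarrow> z \<in> G) \<and> (f y \<in> G \<longleftrightarrow> f z \<in> G)" if y: "y \<in> {p..<q}" for y
    proof -
      have "y \<in> \<Omega>" using p y by blast
      then have "y \<in> G \<longleftrightarrow> z \<in> G" using z J_iff[OF y]
        unfolding G_def avoiding_def mem_Collect_eq by (meson less_imp_le less_SucI)
      moreover have "(f ^^ k) (f y) \<in> {a..<b} \<longleftrightarrow> (f ^^ k) (f z) \<in> {a..<b}" if "k < t" for k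
        using J_iff[OF y, of "Suc k"] that by (simp add: funpow_swap1)
      then have "f y \<in> G \<longleftrightarrow> f z \<in> G"
        using z \<open>y \<in> \<Omega>\<close> map_in_dom_iff by (auto simp: G_def avoiding_def)
      ultimately show ?thesis by blast
    qed
    then show ?thesis using p by blast
  qed
  \<comment> \<open>Here the assumed equality enters: a point that avoids [a, b[ for t steps avoids
    it for one more, so its image still avoids it for t steps.\<close>
  have fwd: "f z \<in> G" if "z \<in> G" for z
  proof -
    have z: "z \<in> avoiding {a..<b} (Suc t)" using that G_Suc by simp
    have "(f ^^ k) (f z) \<notin> {a..<b}" if "k < t" for k
    proof -
      have "(f ^^ Suc k) z \<notin> {a..<b}" using z that unfolding avoiding_def by blast
      then show ?thesis by (simp add: funpow_swap1)
    qed
    then show ?thesis using z map_in_dom by (auto simp: G_def avoiding_def)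
  qed
  have fwd_n: "(f ^^ n) z \<in> G" if "z \<in> G" for n z
    using that by (induction n) (auto intro: fwd)
  \<comment> \<open>If z is outside \<open>G\<close> and \<open>f z\<close> inside, the same holds
    on a whole cell containing z. Recurrence brings a point of that cell back to the cell, while all
    its later iterates are in \<open>G\<close>.\<close>
  have inv: "f z \<in> G \<longleftrightarrow> z \<in> G" if z: "z \<in> \<Omega>" for z
  proof
    assume fz: "f z \<in> G"
    show "z \<in> G"
    proof (rule ccontr)
      assume nz: "z \<notin> G"
      obtain p q where p: "p \<le> z" "z < q" "{p..<q} \<subseteq> \<Omega>"
        "\<forall>y\<in>{p..<q}. (y \<in> G \<longleftrightarrow> z \<in> G) \<and> (f y \<in> G \<longleftrightarrow> f z \<in> G)"
        using cells[OF z] by blast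
      have "p < q" using p by simp
      obtain n y where n: "n \<ge> 1" "y \<in> {p..<q}" "(f ^^ n) y \<in> {p..<q}"
        using poincare_recurrence[OF \<open>p < q\<close> p(3)] by blast
      have "f y \<in> G" using p(4) n(2) fz by blast
      then have "(f ^^ (n - 1)) (f y) \<in> G" by (rule fwd_n)
      then have "(f ^^ n) y \<in> G" using n(1) by (metis Suc_diff_1 Suc_le_lessD One_nat_def comp_apply funpow_Suc_right)
      then show False using p(4) n(3) nz by blast
    qed
  qed (rule fwd)
  \<comment> \<open>Jumps are sought on the left only: cells are closed on the left, so the
    indicator of \<open>G\<close> is constant just to the right of any point.\<close>
  define jump where "jump x \<longleftrightarrow> x \<in> \<Omega> \<and> x \<noteq> lft \<and>
      (\<forall>e>0. \<exists>y. y \<in> \<Omega> \<and> x - e < y \<and> y < x \<and> (y \<in> G) \<noteq> (x \<in> G))" for x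
  have "{x. jump x} \<subseteq> ?Q"
  proof
    fix x assume "x \<in> {x. jump x}"
    then have x: "x \<in> \<Omega>" "\<And>e. e > 0 \<Longrightarrow> \<exists>y. y \<in> \<Omega> \<and> x - e < y \<and> y < x \<and> (y \<in> G) \<noteq> (x \<in> G)"
      unfolding jump_def by auto
    obtain p q where p: "p \<in> ?Q" "p \<le> x" "x < q" "\<forall>y\<in>{p..<q}. y \<in> G \<longleftrightarrow> x \<in> G"
      using cells[OF x(1)] by blast
    have "p = x"
    proof (rule ccontr)
      assume "p \<noteq> x"
      then obtain y where y: "x - (x - p) < y" "y < x" "(y \<in> G) \<noteq> (x \<in> G)"
        using x(2)[of "x - p"] p(2) by auto
      then have "y \<in> {p..<q}" using p(3) by auto
      then show False using p(4) y(3) by blast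
    qed
    then show "x \<in> ?Q" using p(1) by simp
  qed
  then have fin: "finite {x. jump x}"
    by (rule finite_subset) (intro finite_preimages, auto)
  \<comment> \<open>Otherwise the indicator of \<open>G\<close> would be locally constant on the
    connected domain, although \<open>G\<close> is nonempty and does not contain a.\<close>
  have "\<exists>x. jump x"
  proof (rule ccontr)
    assume nj: "\<not> (\<exists>x. jump x)"
    obtain z where z: "z \<in> G" using ne by (auto simp: G_def)
    have a: "a \<in> \<Omega>" using J by auto
    have "(z \<in> G) = (a \<in> G)"
    proof (rule connected_local_const[where A = \<Omega> and f = "\<lambda>x. x \<in> G"])
      show "connected \<Omega>" unfolding dom_interval by simp
      show "\<forall>x\<in>\<Omega>. eventually (\<lambda>y. (x \<in> G) = (y \<in> G)) (at x within \<Omega>)"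
      proof
        fix x assume x: "x \<in> \<Omega>"
        obtain p q where p: "p \<le> x" "x < q" "\<forall>y\<in>{p..<q}. y \<in> G \<longleftrightarrow> x \<in> G"
          using cells[OF x] by blast
        have "\<exists>e>0. \<forall>y. y \<in> \<Omega> \<and> x - e < y \<and> y < x \<longrightarrow> (y \<in> G) = (x \<in> G)"
        proof (cases "x = lft")
          case True
          then show ?thesis by (intro exI[of _ 1]) (auto simp: iet_dom_def)
        next
          case False
          then show ?thesis using nj x unfolding jump_def by blast
        qed
        then obtain e where e: "e > 0" "\<And>y. y \<in> \<Omega> \<Longrightarrow> x - e < y \<Longrightarrow> y < x \<Longrightarrow> (y \<in> G) = (x \<in> G)" by blast
        show "eventually (\<lambda>y. (x \<in> G) = (y \<in> G)) (at x within \<Omega>)"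
          unfolding eventually_at
        proof (intro exI[of _ "min e (q - x)"] conjI ballI impI)
          show "0 < min e (q - x)" using e(1) p(2) by simp
          fix y assume y: "y \<in> \<Omega>" "y \<noteq> x \<and> dist y x < min e (q - x)"
          show "(x \<in> G) = (y \<in> G)"
          proof (cases "y < x")
            case True
            then show ?thesis using e(2)[of y] y by (auto simp: dist_real_def)
          next
            case False
            then have "y \<in> {p..<q}" using y p(1,2) by (auto simp: dist_real_def)
            then show ?thesis using p(3) by blast
          qed
        qed
      qed
    qed (use z a G_dom in auto)
    moreover have "a \<notin> avoiding {a..<b} (Suc t)" using J(1) by (force simp: avoiding_def intro: exI[of _ 0])
    ultimately show False using z G_Suc by simp
  qed
  then obtain x where x: "jump x" by blast
  \<comment> \<open>From the start of its exchanged interval up to y, \<open>f\<close> is a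
    translation that preserves membership in \<open>G\<close>, so it carries jumps in both
    directions.\<close>
  have step: "jump y \<longleftrightarrow> jump (f y)" if y: "y \<in> \<Omega>" "y \<notin> \<gamma> ` {1..s}" for y
  proof -
    define p where "p = \<gamma> (iet_letter T y)"
    define c where "c = f y - y"
    note l = letter[OF y(1)]
    have "p \<noteq> y" using y(2) imageI[OF l(1), of \<gamma>] unfolding p_def by metis
    moreover have "p \<le> y" using l(2) unfolding p_def by (simp add: iet_interval_def)
    ultimately have p: "p < y" "p \<in> \<Omega>" "lft \<le> p"
      using gamma_in_dom[OF l(1)] unfolding p_def by (auto simp: iet_dom_def)
    have tr: "f w = w + c" if "w \<in> {p..y}" for w
    proof -
      have "w \<in> iet_interval T (iet_letter T y)" using that l unfolding p_def by (auto simp: iet_interval_def)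
      then show ?thesis using map_on_interval[OF l(1)] l(2) unfolding c_def by simp
    qed
    have dom: "w \<in> \<Omega>" if "w \<in> {p..y}" for w using that p y by (auto simp: iet_dom_def)
    have "lft \<le> f p" using map_in_dom[OF p(2)] by (simp add: iet_dom_def)
    then have ne: "f y \<noteq> lft" "y \<noteq> lft" using tr[of p] tr[of y] p by auto
    have shift: "w \<in> \<Omega> \<and> (w \<in> G) = (w + c \<in> G) \<and> w + c \<in> \<Omega>" if "w \<in> {p..y}" for w
      using tr[OF that] inv[OF dom[OF that]] dom[OF that] map_in_dom by metis
    show ?thesis
    proof
      assume j: "jump y"
      have "\<exists>v. v \<in> \<Omega> \<and> f y - e < v \<and> v < f y \<and> (v \<in> G) \<noteq> (f y \<in> G)" if e: "e > 0" for e
      proof -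
        have "min e (y - p) > 0" using e p by simp
        then obtain w where w: "y - min e (y - p) < w" "w < y" "(w \<in> G) \<noteq> (y \<in> G)"
          using j unfolding jump_def by blast
        then show ?thesis using shift[of w] shift[of y] tr[of y] p by (intro exI[of _ "w + c"]) auto
      qed
      then show "jump (f y)" unfolding jump_def using ne map_in_dom y by blast
    next
      assume j: "jump (f y)"
      have "\<exists>v. v \<in> \<Omega> \<and> y - e < v \<and> v < y \<and> (v \<in> G) \<noteq> (y \<in> G)" if e: "e > 0" for e
      proof -
        have "min e (y - p) > 0" using e p by simp
        then obtain v where v: "f y - min e (y - p) < v" "v < f y" "(v \<in> G) \<noteq> (f y \<in> G)"
          using j unfolding jump_def by blast
        have "v - c \<in> {p..y}" using v tr[of y] p by auto
        then show ?thesis using v shift[of "v - c"] shift[of y] tr[of y] p by (intro exI[of _ "v - c"]) auto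
      qed
      then show "jump y" unfolding jump_def using ne y by blast
    qed
  qed
  have inj: "inj (\<lambda>n::int. P n x)"
  proof -
    have False if "m < n" "P m x = P n x" for m n :: int
    proof -
      have "P (n - m) x = P (- m) (P n x)" by (simp flip: pow_add)
      also have "\<dots> = x" using that(2) by (metis pow_inverse(1))
      finally have "(f ^^ nat (n - m)) x = x" using that(1) by (metis pow_nat int_nat_eq diff_ge_0_iff_ge less_imp_le)
      then show False using aperiodic[of x "nat (n - m)"] x that(1) unfolding jump_def by simp
    qed
    then show ?thesis by (intro injI) (metis linorder_neqE)
  qed
  \<comment> \<open>The orbit is infinite and the jumps are finitely many, so the chain of jumps
    must break at a separation point. The first one met is still a jump, hence different from
    \<open>lft\<close>.\<close>
  have "\<exists>n. (f ^^ n) x \<in> \<gamma> ` {1..s}"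
  proof (rule ccontr)
    assume n: "\<not> (\<exists>n. (f ^^ n) x \<in> \<gamma> ` {1..s})"
    have "jump ((f ^^ n) x)" for n
    proof (induction n)
      case (Suc n)
      then show ?case using step[of "(f ^^ n) x"] n unfolding jump_def by auto
    qed (use x in simp)
    then have "(\<lambda>n. P n x) ` range int \<subseteq> {x. jump x}" by (auto simp: pow_nat)
    moreover have "infinite ((\<lambda>n. P n x) ` range int)"
      using finite_imageD[OF _ inj_on_subset[OF inj]] finite_imageD[of int UNIV] by auto
    ultimately show False using fin finite_subset by blast
  qed
  then obtain n where n: "(f ^^ n) x \<in> \<gamma> ` {1..s}" "\<And>k. k < n \<Longrightarrow> (f ^^ k) x \<notin> \<gamma> ` {1..s}"
    using exists_least_iff[of "\<lambda>n. (f ^^ n) x \<in> \<gamma> ` {1..s}"] by blast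
  have "jump ((f ^^ k) x)" if "k \<le> n" for k
    using that
  proof (induction k)
    case (Suc k)
    then show ?case using step[of "(f ^^ k) x"] n(2)[of k] unfolding jump_def by auto
  qed (use x in simp)
  then have "(f ^^ n) x \<noteq> lft" unfolding jump_def by blast
  moreover obtain j where j1: "j \<in> {1..s}" "(f ^^ n) x = \<gamma> j" using n(1) by blast
  ultimately have "j \<noteq> 1" using gamma_1 by auto
  then have j: "j \<in> {2..s}" "(f ^^ n) x = \<gamma> j" using j1 by auto
  \<comment> \<open>The backward search starts at \<open>m = 1\<close>, so that the connection from
    \<open>\<gamma> i\<close> to \<open>\<gamma> j\<close> has positive length even when x is itself
    a separation point.\<close>
  have "\<exists>m\<ge>1. P (- int m) x \<in> \<gamma> ` {1..s}"
  proof (rule ccontr)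
    assume m: "\<not> (\<exists>m\<ge>1. P (- int m) x \<in> \<gamma> ` {1..s})"
    have "jump (P (- int m) x)" for m
    proof (induction m)
      case (Suc m)
      have "f (P (- int (Suc m)) x) = P (- int m) x" using pow_Suc[of "- int (Suc m)" x] by simp
      moreover have "P (- int (Suc m)) x \<in> \<Omega>" using x unfolding jump_def by simp
      moreover have "P (- int (Suc m)) x \<notin> \<gamma> ` {1..s}" using m by (metis le_add1 plus_1_eq_Suc)
      ultimately show ?case using step[of "P (- int (Suc m)) x"] Suc by simp
    qed (use x in simp)
    then have "(\<lambda>n. P n x) ` range (\<lambda>m. - int m) \<subseteq> {x. jump x}" by auto
    moreover have "infinite ((\<lambda>n. P n x) ` range (\<lambda>m. - int m))"
      using finite_imageD[OF _ inj_on_subset[OF inj]] finite_imageD[of "\<lambda>m. - int m" UNIV]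
      by (auto simp: inj_on_def)
    ultimately show False using fin finite_subset by blast
  qed
  then obtain m i where m: "m \<ge> 1" "P (- int m) x = \<gamma> i" "i \<in> {1..s}" by auto
  have "P (int n + int m) (\<gamma> i) = \<gamma> j"
    using m(2) j(2) by (metis pow_add pow_inverse(2) pow_nat)
  then show False using no_connection[OF m(3) j(1), of "int n + int m"] m(1) by simp
qed

end

section \<open>Linear recurrence over a quadratic field\<close>

locale quadratic_exchange = regular_exchange + quadratic +
  fixes B :: real
  assumes B: "1 \<le> B" and qint_len: "\<And>i. i \<in> {1..s} \<Longrightarrow> qint d N B (\<Lambda> i)"
begin

text \<open>\<open>A / 2\<close> bounds the conjugates of all sums of distinct lengths, and
  \<open>A\<close> those of the displacements \<open>f z - z\<close>, which are differences of two
  such sums.\<close>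

definition A :: real where "A = 2 * real s * B"

lemma A_ge_1: "1 \<le> A"
  using s_pos B mult_mono[of 1 "2 * real s" 1 B] unfolding A_def by simp

lemma qint_len_sum:
  assumes "X \<subseteq> {1..s}"
  shows "qint d N (A / 2) (sum \<Lambda> X)"
proof (rule qint_mono)
  show "qint d N (real (card X) * B) (sum \<Lambda> X)"
    by (rule qint_sum) (use assms qint_len finite_subset in auto)
  have "card X \<le> s" using card_mono[OF _ assms] by simp
  then show "real (card X) * B \<le> A / 2" using B by (simp add: A_def mult_right_mono)
qed

text \<open>Positions are always measured from \<open>lft\<close>, since \<open>lft\<close> itself
  may lie outside the field.\<close>

lemma qint_gamma:
  assumes "i \<in> {1..s}"
  shows "qint d N (A / 2) (\<gamma> i - lft)"
proof -
  have "{1..<i} \<subseteq> {1..s}" using assms by auto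
  from qint_len_sum[OF this] show ?thesis by (simp add: iet_gamma_def)
qed

lemma qint_rgt: "qint d N (A / 2) (rgt - lft)"
  using qint_len_sum[of "{1..s}"] by (simp add: iet_right_def)

lemma qint_map:
  assumes "z \<in> \<Omega>"
  shows "qint d N A (f z - z)"
proof -
  let ?i = "iet_letter T z"
  have "{j \<in> {1..s}. \<pi> j < \<pi> ?i} \<subseteq> {1..s}" by blast
  from qint_len_sum[OF this] have "qint d N (A / 2) (\<delta> ?i - lft)"
    by (simp add: iet_delta_def)
  from qint_diff[OF this qint_gamma[OF letter(1)[OF assms]]]
  show ?thesis using map_on_interval[OF letter[OF assms]] by simp
qed

lemma qint_iter:
  assumes "z \<in> \<Omega>"
  shows "qint d N (real n * A) ((f ^^ n) z - z)"
proof (induction n)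
  case (Suc n)
  have "qint d N (A + real n * A) ((f ((f ^^ n) z) - (f ^^ n) z) + ((f ^^ n) z - z))"
    by (intro qint_add Suc qint_map) (use assms in simp)
  then show ?case by (simp add: algebra_simps)
qed (simp add: qint_0)

lemma qint_pow:
  assumes "z \<in> \<Omega>"
  shows "qint d N (\<bar>real_of_int n\<bar> * A) (P n z - z)"
proof (cases "n \<ge> 0")
  case True
  then show ?thesis using qint_iter[OF assms, of "nat n"] by (simp flip: pow_nat)
next
  case False
  have "qint d N (real (nat (- n)) * A) ((f ^^ nat (- n)) (P n z) - P n z)"
    by (rule qint_iter) (use assms in simp)
  moreover have "(f ^^ nat (- n)) (P n z) = z" using False by (simp flip: pow_nat)
  ultimately have "qint d N (real (nat (- n)) * A) (z - P n z)" by simp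
  from qint_minus[OF this] show ?thesis using False by simp
qed

text \<open>Going back k steps costs \<open>k * A\<close>; the marked point that is reached costs at
  most \<open>A + D\<close>, whichever of the two kinds it is.\<close>

lemma qint_preimages:
  assumes "p \<in> preimages n (\<gamma> ` {1..s} \<union> C)" "\<And>c. c \<in> C \<Longrightarrow> qint d N D (c - lft)" "0 \<le> D"
  shows "qint d N (real (Suc n) * A + D) (p - lft)"
proof -
  obtain k where k: "k \<le> n" "(f ^^ k) p \<in> \<gamma> ` {1..s} \<union> C" "p \<in> \<Omega>"
    using assms(1) unfolding preimages_def by blast
  have 1: "qint d N (real k * A) (p - (f ^^ k) p)"
    using qint_minus[OF qint_iter[OF k(3)]] by simp
  have 2: "qint d N (A + D) ((f ^^ k) p - lft)"
    using k(2)
  proof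
    assume "(f ^^ k) p \<in> \<gamma> ` {1..s}"
    then obtain i where i: "i \<in> {1..s}" "(f ^^ k) p = \<gamma> i" by blast
    show ?thesis unfolding i(2) by (rule qint_mono[OF qint_gamma[OF i(1)]]) (use A_ge_1 assms(3) in simp)
  next
    assume "(f ^^ k) p \<in> C"
    then show ?thesis by (rule qint_mono[OF assms(2)]) (use A_ge_1 in simp)
  qed
  have "qint d N (real k * A + (A + D)) ((p - (f ^^ k) p) + ((f ^^ k) p - lft))"
    by (rule qint_add[OF 1 2])
  moreover have "real k * A + (A + D) \<le> real (Suc n) * A + D"
    using k(1) A_ge_1 by (simp add: algebra_simps mult_left_mono)
  ultimately show ?thesis using qint_mono by fastforce
qed

text \<open>Minimality, as \<open>avoiding_strict\<close>, provides a point that hits first at time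
  t, and its whole cell does the same. The length of the cell is a nonzero quadratic integer with
  conjugate at most twice \<open>real (Suc t) * A + D\<close>, so it cannot be too small.\<close>

lemma first_hit_cell:
  assumes "a < b" "{a..<b} \<subseteq> \<Omega>" "b < rgt" "qint d N D (a - lft)" "qint d N D (b - lft)"
    and ne: "avoiding {a..<b} t \<noteq> {}"
  shows "\<exists>p q. p < q \<and> {p..<q} \<subseteq> avoiding {a..<b} t - avoiding {a..<b} (Suc t) \<and>
    1 / (2 * real N * (real (Suc t) * A + D)) \<le> q - p"
proof -
  let ?G = "avoiding {a..<b}"
  have "?G t \<noteq> ?G (Suc t)" by (rule avoiding_strict[OF assms(1,2) ne])
  moreover have "?G (Suc t) \<subseteq> ?G t" by (auto simp: avoiding_def)
  ultimately obtain z where z: "z \<in> ?G t" "z \<notin> ?G (Suc t)" by blast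
  have z\<Omega>: "z \<in> \<Omega>" using z by (simp add: avoiding_def)
  let ?C = "{a, b}"
  have finC: "finite ?C" by simp
  obtain p q where p: "p \<in> preimages t (\<gamma> ` {1..s} \<union> ?C)" "p \<le> z" "z < q"
      "q \<in> preimages t (\<gamma> ` {1..s} \<union> ?C) \<or> q = rgt" "q \<le> rgt"
      "{p..<q} \<subseteq> \<Omega>"
      "\<forall>y\<in>{p..<q}. \<forall>k\<le>t. (f ^^ k) y = y + ((f ^^ k) p - p)"
      "\<forall>y\<in>{p<..<q}. \<forall>k\<le>t. (f ^^ k) y \<notin> \<gamma> ` {1..s} \<union> ?C"
    by (rule translation_cell[OF finC z\<Omega>])
  have J_iff: "(f ^^ k) y \<in> {a..<b} \<longleftrightarrow> (f ^^ k) z \<in> {a..<b}" if "y \<in> {p..<q}" "k \<le> t" for y k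
  proof (rule cell_membership[where p = p and q = q and g = "f ^^ k"])
    show "(f ^^ k) w = w + ((f ^^ k) p - p)" if "w \<in> {p..<q}" for w
      using p(7) that \<open>k \<le> t\<close> by blast
    show "(f ^^ k) w \<notin> {a, b}" if "w \<in> {p<..<q}" for w
      using p(8) that \<open>k \<le> t\<close> by blast
  qed (use that p(2,3) in auto)
  have sub: "{p..<q} \<subseteq> ?G t - ?G (Suc t)"
  proof
    fix y assume y: "y \<in> {p..<q}"
    have "y \<in> \<Omega>" using p(6) y by blast
    moreover have "(f ^^ k) y \<notin> {a..<b}" if "k < t" for k
      using J_iff[OF y, of k] z(1) that unfolding avoiding_def by auto
    moreover have "(f ^^ t) y \<in> {a..<b}"
      using J_iff[OF y, of t] z unfolding avoiding_def by (auto simp: less_Suc_eq)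
    ultimately show "y \<in> ?G t - ?G (Suc t)" unfolding avoiding_def by blast
  qed
  let ?E = "real (Suc t) * A + D"
  have D: "0 \<le> D" using assms(4) by (rule qint_nonneg)
  have C: "qint d N D (c - lft)" if "c \<in> ?C" for c using that assms(4,5) by auto
  have pE: "qint d N ?E (p - lft)" by (rule qint_preimages[OF p(1) C D])
  have qE: "qint d N ?E (q - lft)"
    using p(4)
  proof
    assume "q = rgt"
    moreover have "A / 2 \<le> ?E" using A_ge_1 D mult_nonneg_nonneg[of "real t" A] by (simp add: algebra_simps)
    ultimately show ?thesis using qint_mono[OF qint_rgt] by simp
  qed (rule qint_preimages[OF _ C D])
  have "qint d N (2 * ?E) (q - p)" using qint_diff[OF qE pE] unfolding mult_2 by simp
  then have "1 \<le> real N * \<bar>q - p\<bar> * (2 * ?E)" by (rule qint_lower) (use p(2,3) in simp)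
  then have "1 \<le> (q - p) * (2 * real N * ?E)" using p(2,3) by (simp add: mult_ac)
  moreover have "0 < 2 * real N * ?E" using N A_ge_1 D by (intro mult_pos_pos add_pos_nonneg) auto
  ultimately have "1 / (2 * real N * ?E) \<le> q - p" by (simp add: pos_divide_le_eq)
  then show ?thesis using sub p(2,3) by (intro exI[of _ p] exI[of _ q]) auto
qed

lemma ln_increment_le:
  assumes "0 < (x::real)"
  shows "ln (x + 1) - ln x \<le> 1 / x"
proof -
  have "ln (x + 1) - ln x = ln ((x + 1) / x)" using assms by (simp add: ln_div)
  also have "\<dots> \<le> (x + 1) / x - 1" using assms by (intro ln_le_minus_one) simp
  also have "\<dots> = 1 / x" using assms by (simp add: field_simps)
  finally show ?thesis .
qed

text \<open>
  The sets of points hitting \<open>[a, b[\<close> first at time \<open>t\<close> are disjoint and of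
  length at least a constant over \<open>t + 1 + D / A\<close>: the divergence of the harmonic
  series bounds the hitting times.
\<close>

lemma avoiding_time_bound:
  assumes ab: "a < b" "{a..<b} \<subseteq> \<Omega>" "b < rgt" "qint d N D (a - lft)" "qint d N D (b - lft)"
    and ne: "avoiding {a..<b} M \<noteq> {}"
  shows "real M \<le> (1 + D / A) * exp (2 * real N * A * (rgt - lft))"
proof -
  let ?G = "avoiding {a..<b}"
  let ?c = "D / A"
  have D: "0 \<le> D" using ab(4) by (rule qint_nonneg)
  have A0: "0 < A" using A_ge_1 by simp
  have c0: "0 \<le> ?c" using D A0 by simp
  have antimono: "?G n \<subseteq> ?G m" if "m \<le> n" for m n using that by (auto simp: avoiding_def)
  have "\<exists>p q. p < q \<and> {p..<q} \<subseteq> ?G t - ?G (Suc t) \<and> 1 / (2 * real N * (real (Suc t) * A + D)) \<le> q - p"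
    if "t < M" for t
    by (rule first_hit_cell[OF ab]) (use ne antimono[of t M] that in auto)
  then obtain p q where pq: "\<And>t. t < M \<Longrightarrow> p t < q t"
      "\<And>t. t < M \<Longrightarrow> {p t..<q t} \<subseteq> ?G t - ?G (Suc t)"
      "\<And>t. t < M \<Longrightarrow> 1 / (2 * real N * (real (Suc t) * A + D)) \<le> q t - p t"
    by metis
  have "(\<Sum>t<M. 1 / (2 * real N * (real (Suc t) * A + D))) \<le> (\<Sum>t<M. q t - p t)"
    by (rule sum_mono) (use pq(3) in simp)
  also have "\<dots> \<le> rgt - lft"
  proof (rule semi_interval_packing)
    show "{p t..<q t} \<subseteq> {lft..<rgt}" if "t \<in> {..<M}" for t
      using pq(2)[of t] that unfolding dom_interval[symmetric] avoiding_def by auto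
    have dis: "{p i..<q i} \<inter> {p j..<q j} = {}" if "i < j" "j < M" for i j
    proof -
      have "{p i..<q i} \<inter> ?G (Suc i) = {}" "{p j..<q j} \<subseteq> ?G j"
        using pq(2)[of i] pq(2)[of j] that by auto
      with antimono[OF Suc_leI[OF that(1)]] show ?thesis by blast
    qed
    show "{p i..<q i} \<inter> {p j..<q j} = {}" if "i \<in> {..<M}" "j \<in> {..<M}" "i \<noteq> j" for i j
      using dis[of i j] dis[of j i] that by (auto simp: nat_neq_iff Int_commute)
  qed (use pq(1) lft_less_rgt in \<open>auto intro: less_imp_le\<close>)
  finally have S: "(\<Sum>t<M. 1 / (2 * real N * (real (Suc t) * A + D))) \<le> rgt - lft" .
  have "ln (real M + 1 + ?c) - ln (1 + ?c) = (\<Sum>t<M. ln (real (Suc t) + 1 + ?c) - ln (real t + 1 + ?c))"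
    by (subst sum_lessThan_telescope[of "\<lambda>t. ln (real t + 1 + ?c)"]) simp
  also have "\<dots> \<le> (\<Sum>t<M. 2 * real N * A * (1 / (2 * real N * (real (Suc t) * A + D))))"
  proof (rule sum_mono)
    fix t
    have "ln (real (Suc t) + 1 + ?c) - ln (real t + 1 + ?c) \<le> 1 / (real t + 1 + ?c)"
      using ln_increment_le[of "real t + 1 + ?c"] c0 by (simp add: add_ac)
    also have "\<dots> = 2 * real N * A * (1 / (2 * real N * (real (Suc t) * A + D)))"
    proof -
      have "real (Suc t) * A + D = A * (real t + 1 + ?c)" using A0 by (simp add: field_simps)
      then show ?thesis using A0 N by simp
    qed
    finally show "ln (real (Suc t) + 1 + ?c) - ln (real t + 1 + ?c)
      \<le> 2 * real N * A * (1 / (2 * real N * (real (Suc t) * A + D)))" .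
  qed
  also have "\<dots> = 2 * real N * A * (\<Sum>t<M. 1 / (2 * real N * (real (Suc t) * A + D)))"
    by (simp only: sum_distrib_left)
  also have "\<dots> \<le> 2 * real N * A * (rgt - lft)"
    by (rule mult_left_mono[OF S]) (use A0 in simp)
  finally have "ln (real M + 1 + ?c) \<le> ln (1 + ?c) + 2 * real N * A * (rgt - lft)" by simp
  then have "exp (ln (real M + 1 + ?c)) \<le> exp (ln (1 + ?c) + 2 * real N * A * (rgt - lft))"
    by simp
  then have "real M + 1 + ?c \<le> (1 + ?c) * exp (2 * real N * A * (rgt - lft))"
    using c0 by (simp add: exp_add)
  then show ?thesis using c0 by simp
qed

lemma linear_hitting_time:
  obtains C where "0 < C"
    "\<And>u v z. lft \<le> u \<Longrightarrow> u < v \<Longrightarrow> v \<le> rgt \<Longrightarrow> z \<in> \<Omega> \<Longrightarrow>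
      \<exists>n. real n \<le> C / (v - u) \<and> (f ^^ n) z \<in> {u<..<v}"
proof -
  let ?R = "rgt - lft"
  let ?E = "exp (2 * real N * A * ?R)"
  obtain K where K: "K > 0"
    "\<And>\<delta> x. 0 < \<delta> \<Longrightarrow> \<delta> \<le> ?R \<Longrightarrow> 0 \<le> x \<Longrightarrow> x \<le> ?R \<Longrightarrow>
      \<exists>y\<le>x. x < y + \<delta> \<and> qint d N (K / \<delta>) y"
    using qint_dense[of ?R] by metis
  have A0: "0 < A" using A_ge_1 by simp
  \<comment> \<open>With \<open>D = 4 * K / L\<close> the factor \<open>1 + D / A\<close> of
    \<open>avoiding_time_bound\<close> becomes a multiple of \<open>1 / L\<close>, because
    \<open>1 \<le> ?R / L\<close>.\<close>
  let ?C = "(?R + 4 * K / A) * ?E"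
  show thesis
  proof (rule that[of ?C])
    show "0 < ?C" using lft_less_rgt K A0 by (intro mult_pos_pos add_pos_nonneg) auto
    fix u v z assume uv: "lft \<le> u" "u < v" "v \<le> rgt" and z: "z \<in> \<Omega>"
    define L where "L = v - u"
    have L: "0 < L" "L \<le> ?R" using uv by (auto simp: L_def)
    \<comment> \<open>Aiming at \<open>L / 2\<close> and at \<open>7 * L / 8\<close> with errors
      below \<open>L / 4\<close> places a in ]u + L/4, u + L/2] and b in ]u + 5L/8, u + 7L/8], so
      that u < a < b < v.\<close>
    obtain y where y: "y \<le> u - lft + L / 2" "u - lft + L / 2 < y + L / 4" "qint d N (K / (L / 4)) y"
    proof -
      have "u - lft + L / 2 \<le> ?R" "0 \<le> u - lft + L / 2" "0 < L / 4" "L / 4 \<le> ?R"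
        using L uv by (auto simp: L_def field_simps)
      then show thesis using K(2) that by blast
    qed
    obtain y' where y': "y' \<le> u - lft + 7 * L / 8" "u - lft + 7 * L / 8 < y' + L / 4" "qint d N (K / (L / 4)) y'"
    proof -
      have "u - lft + 7 * L / 8 \<le> ?R" "0 \<le> u - lft + 7 * L / 8" "0 < L / 4" "L / 4 \<le> ?R"
        using L uv by (auto simp: L_def field_simps)
      then show thesis using K(2) that by blast
    qed
    let ?D = "4 * K / L"
    define a where "a = lft + y"
    define b where "b = lft + y'"
    have ab: "a < b" "u < a" "b < v" 
    proof -
      have "v = u + L" by (simp add: L_def)
      then show "a < b" "u < a" "b < v" unfolding a_def b_def using y(1,2) y'(1,2) L(1) by linarith+
    qed
    have q: "qint d N ?D (a - lft)" "qint d N ?D (b - lft)" using y(3) y'(3) by (auto simp: a_def b_def mult.commute)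
    have J: "{a..<b} \<subseteq> \<Omega>" "b < rgt" using ab uv by (auto simp: iet_dom_def)
    \<comment> \<open>An integer above the bound of \<open>avoiding_time_bound\<close>: no point
      avoids [a, b[ for that long.\<close>
    let ?M = "Suc (nat \<lfloor>(1 + ?D / A) * ?E\<rfloor>)"
    have "avoiding {a..<b} ?M = {}"
    proof (rule ccontr)
      assume "avoiding {a..<b} ?M \<noteq> {}"
      from avoiding_time_bound[OF ab(1) J q this]
      show False by linarith
    qed
    then obtain n where n: "n < ?M" "(f ^^ n) z \<in> {a..<b}" using z unfolding avoiding_def by blast
    have p: "0 \<le> (1 + ?D / A) * ?E" using K L A0 by (intro mult_nonneg_nonneg add_nonneg_nonneg) auto
    have "real n \<le> (1 + ?D / A) * ?E" using n(1) p by linarith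
    also have "\<dots> \<le> (?R / L + 4 * K / A / L) * ?E"
      using L by (intro mult_right_mono add_mono) (auto simp: mult.commute)
    also have "\<dots> = ?C / L" using L(1) A0 by (simp add: field_simps)
    finally have "real n \<le> ?C / (v - u)" by (simp add: L_def)
    moreover have "(f ^^ n) z \<in> {u<..<v}" using n(2) ab by auto
    ultimately show "\<exists>n. real n \<le> ?C / (v - u) \<and> (f ^^ n) z \<in> {u<..<v}" by blast
  qed
qed

text \<open>Backward hitting reduces to forward hitting: go back by the largest possible hitting
  time, then forward until the interval is met, which happens no later than at z. The term
  \<open>rgt - lft\<close> added to the constant pays for the one extra step that makes the forward
  time positive.\<close>

lemma linear_return_time:
  obtains C where "0 < C"
    "\<And>u v z. lft \<le> u \<Longrightarrow> u < v \<Longrightarrow> v \<le> rgt \<Longrightarrow> z \<in> \<Omega> \<Longrightarrow>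
      \<exists>n>0. real n \<le> C / (v - u) \<and> P (int n) z \<in> {u<..<v}"
    "\<And>u v z. lft \<le> u \<Longrightarrow> u < v \<Longrightarrow> v \<le> rgt \<Longrightarrow> z \<in> \<Omega> \<Longrightarrow>
      \<exists>n. real n \<le> C / (v - u) \<and> P (- int n) z \<in> {u<..<v}"
proof -
  obtain C where C: "0 < C"
    "\<And>u v z. lft \<le> u \<Longrightarrow> u < v \<Longrightarrow> v \<le> rgt \<Longrightarrow> z \<in> \<Omega> \<Longrightarrow>
      \<exists>n. real n \<le> C / (v - u) \<and> (f ^^ n) z \<in> {u<..<v}"
    using linear_hitting_time by metis
  let ?R = "rgt - lft"
  show thesis
  proof (rule that[of "C + ?R"])
    show "0 < C + ?R" using C lft_less_rgt by simp
    fix u v z assume uv: "lft \<le> u" "u < v" "v \<le> rgt" and z: "z \<in> \<Omega>"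
    have le: "C / (v - u) + 1 \<le> (C + ?R) / (v - u)" using uv by (simp add: add_divide_distrib)
    obtain n where n: "real n \<le> C / (v - u)" "(f ^^ n) (f z) \<in> {u<..<v}"
      using C(2)[OF uv map_in_dom[OF z]] by blast
    have "P (int (Suc n)) z \<in> {u<..<v}" using n(2) unfolding pow_nat by (simp add: funpow_swap1)
    then show "\<exists>n>0. real n \<le> (C + ?R) / (v - u) \<and> P (int n) z \<in> {u<..<v}"
      using n(1) le by (intro exI[of _ "Suc n"]) auto
    define M where "M = nat \<lfloor>C / (v - u)\<rfloor>"
    have M: "real M \<le> C / (v - u)" using C(1) uv by (simp add: M_def)
    obtain m where m: "real m \<le> C / (v - u)" "(f ^^ m) (P (- int M) z) \<in> {u<..<v}"
      using C(2)[OF uv, of "P (- int M) z"] z by auto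
    have "m \<le> M" using m(1) unfolding M_def by (simp add: le_nat_floor)
    moreover have "P (- int M + int m) z \<in> {u<..<v}"
      using m(2) by (metis add.commute pow_add pow_nat)
    ultimately have "P (- int (M - m)) z \<in> {u<..<v}" by (simp add: of_nat_diff)
    moreover have "real (M - m) \<le> (C + ?R) / (v - u)" using M le by linarith
    ultimately show "\<exists>n. real n \<le> (C + ?R) / (v - u) \<and> P (- int n) z \<in> {u<..<v}" by blast
  qed
qed

end

section \<open>Interval exchanges from piecewise translations\<close>

text \<open>The images of the pieces are disjoint by injectivity, and comparing total lengths shows
  that they leave no gap. Adjacent pieces may move by the same translation, so the number of pieces
  can be prescribed as s.\<close>

lemma iet_of_piecewise_translation:
  fixes S :: "real \<Rightarrow> real" and \<beta> :: "nat \<Rightarrow> real" and n :: nat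
  assumes n: "1 \<le> n" and \<beta>: "\<And>i. i \<in> {1..n} \<Longrightarrow> \<beta> i < \<beta> (Suc i)"
    and into: "\<And>z. z \<in> {\<beta> 1..<\<beta> (Suc n)} \<Longrightarrow> S z \<in> {\<beta> 1..<\<beta> (Suc n)}"
    and inj: "inj_on S {\<beta> 1..<\<beta> (Suc n)}"
    and tr: "\<And>i z. i \<in> {1..n} \<Longrightarrow> z \<in> {\<beta> i..<\<beta> (Suc i)} \<Longrightarrow> S z = z + (S (\<beta> i) - \<beta> i)"
  shows "\<exists>D. is_iet D \<and> iet_num D = n \<and> iet_dom D = {\<beta> 1..<\<beta> (Suc n)} \<and>
    iet_len D = (\<lambda>i. \<beta> (Suc i) - \<beta> i) \<and> (\<forall>z\<in>{\<beta> 1..<\<beta> (Suc n)}. iet_map D z = S z)"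
proof -
  let ?I = "{\<beta> 1..<\<beta> (Suc n)}"
  define w where "w = (\<lambda>i. \<beta> (Suc i) - \<beta> i)"
  define x where "x = (\<lambda>i. S (\<beta> i))"
  have w: "0 < w i" if "i \<in> {1..n}" for i using \<beta>[OF that] by (simp add: w_def)
  have sum_w: "sum w {1..<i} = \<beta> i - \<beta> 1" if "1 \<le> i" for i
    unfolding w_def by (rule sum_Suc_diff'[OF that])
  have mono: "\<beta> i \<le> \<beta> j" if "1 \<le> i" "i \<le> j" "j \<le> Suc n" for i j
  proof -
    have "sum w {1..<i} \<le> sum w {1..<j}"
      by (rule sum_mono2) (use that w in \<open>auto intro: less_imp_le\<close>)
    then show ?thesis using sum_w[of i] sum_w[of j] that by simp
  qed
  have piece: "{\<beta> i..<\<beta> (Suc i)} \<subseteq> ?I" if "i \<in> {1..n}" for i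
    using mono[of 1 i] mono[of "Suc i" "Suc n"] that by auto
  have apart: "z = z'" if "i \<in> {1..n}" "j \<in> {1..n}" "z \<in> {\<beta> i..<\<beta> (Suc i)}" "z' \<in> {\<beta> j..<\<beta> (Suc j)}"
      "S z = S z'" for i j z z'
    using inj_onD[OF inj that(5)] piece that by blast
  have same: "i = j" if "i \<in> {1..n}" "j \<in> {1..n}" "z \<in> {\<beta> i..<\<beta> (Suc i)}" "z \<in> {\<beta> j..<\<beta> (Suc j)}" for i j z
  proof (rule ccontr)
    assume "i \<noteq> j"
    then consider "Suc i \<le> j" | "Suc j \<le> i" by linarith
    then show False using mono[of "Suc i" j] mono[of "Suc j" i] that by cases auto
  qed
  have img: "y - (x i - \<beta> i) \<in> {\<beta> i..<\<beta> (Suc i)} \<and> S (y - (x i - \<beta> i)) = y"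
    if "i \<in> {1..n}" "y \<in> {x i..<x i + w i}" for i y
    using that tr[of i "y - (x i - \<beta> i)"] by (auto simp: x_def w_def)
  have img_sub: "{x i..<x i + w i} \<subseteq> ?I" if "i \<in> {1..n}" for i
    using img[OF that] piece[OF that] into by (metis subsetD subsetI)
  have disj: "{x i..<x i + w i} \<inter> {x j..<x j + w j} = {}"
    if "i \<in> {1..n}" "j \<in> {1..n}" "i \<noteq> j" for i j
  proof (rule ccontr)
    assume "\<not> ?thesis"
    then obtain y where y: "y \<in> {x i..<x i + w i}" "y \<in> {x j..<x j + w j}" by blast
    have "y - (x i - \<beta> i) = y - (x j - \<beta> j)"
      using apart[OF that(1,2)] img[OF that(1) y(1)] img[OF that(2) y(2)] by simp
    then show False using same[OF that(1,2)] img[OF that(1) y(1)] img[OF that(2) y(2)] that(3) by metis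
  qed
  have order: "x i + w i \<le> x j" if "i \<in> {1..n}" "j \<in> {1..n}" "x i < x j" for i j
  proof (rule ccontr)
    assume "\<not> ?thesis"
    then have "x j \<in> {x i..<x i + w i}" "x j \<in> {x j..<x j + w j}" using that w by auto
    then show False using disj[of i j] that by blast
  qed
  have x_inj: "i = j" if "i \<in> {1..n}" "j \<in> {1..n}" "x i = x j" for i j
    using disj[OF that(1,2)] w[OF that(1)] w[OF that(2)] that(3) by fastforce
  \<comment> \<open>Pieces are ranked by the positions of their images; outside
    \<open>{1..n}\<close> the value is i, as \<open>permutes\<close> demands.\<close>
  define \<sigma> where "\<sigma> = (\<lambda>i. if i \<in> {1..n} then card {j \<in> {1..n}. x j \<le> x i} else i)"
  have \<sigma>_less: "\<sigma> i < \<sigma> j" if "i \<in> {1..n}" "j \<in> {1..n}" "x i < x j" for i j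
  proof -
    have "{k \<in> {1..n}. x k \<le> x i} \<subset> {k \<in> {1..n}. x k \<le> x j}"
    proof (rule psubsetI)
      have "j \<in> {k \<in> {1..n}. x k \<le> x j}" "j \<notin> {k \<in> {1..n}. x k \<le> x i}" using that by auto
      then show "{k \<in> {1..n}. x k \<le> x i} \<noteq> {k \<in> {1..n}. x k \<le> x j}" by metis
    qed (use that in auto)
    then have "card {k \<in> {1..n}. x k \<le> x i} < card {k \<in> {1..n}. x k \<le> x j}" by (intro psubset_card_mono) auto
    then show ?thesis using that by (simp add: \<sigma>_def)
  qed
  have \<sigma>_iff: "\<sigma> j < \<sigma> i \<longleftrightarrow> x j < x i" if "i \<in> {1..n}" "j \<in> {1..n}" for i j
    using \<sigma>_less[OF that] \<sigma>_less[OF that(2,1)] x_inj[OF that] by (metis linorder_less_linear order_less_asym)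
  have perm: "\<sigma> permutes {1..n}"
  proof (rule bij_imp_permutes)
    have "\<sigma> ` {1..n} \<subseteq> {1..n}"
    proof
      fix k assume "k \<in> \<sigma> ` {1..n}"
      then obtain i where i: "i \<in> {1..n}" "k = card {j \<in> {1..n}. x j \<le> x i}" by (auto simp: \<sigma>_def)
      have "card {j \<in> {1..n}. x j \<le> x i} \<le> card {1..n}" by (rule card_mono) auto
      moreover have "0 < card {j \<in> {1..n}. x j \<le> x i}" using i(1) by (subst card_gt_0_iff) auto
      ultimately show "k \<in> {1..n}" unfolding i(2) by simp
    qed
    moreover have "inj_on \<sigma> {1..n}"
      by (rule inj_onI) (metis \<sigma>_less x_inj linorder_less_linear less_irrefl)
    ultimately show "bij_betw \<sigma> {1..n} {1..n}"
      by (simp add: bij_betw_def endo_inj_surj)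
  qed (simp only: \<sigma>_def if_False)
  define D where "D = \<lparr>iet_left = \<beta> 1, iet_num = n, iet_len = w, iet_perm = \<sigma>\<rparr>"
  have D [simp]: "iet_left D = \<beta> 1" "iet_num D = n" "iet_len D = w" "iet_perm D = \<sigma>"
    by (simp_all add: D_def)
  have iet: "is_iet D" unfolding is_iet_def using n w perm by simp
  have total: "sum w {1..n} = \<beta> (Suc n) - \<beta> 1"
    using sum_w[of "Suc n"] by (simp add: atLeastLessThanSuc_atLeastAtMost)
  have dom: "iet_dom D = ?I" by (simp add: iet_dom_def iet_right_def total[unfolded One_nat_def])
  have gamma: "iet_gamma D i = \<beta> i" if "i \<in> {1..n}" for i
    using sum_w[of i] that by (simp add: iet_gamma_def)
  have delta: "iet_delta D i = x i" if i: "i \<in> {1..n}" for i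
  proof -
    let ?lo = "{j \<in> {1..n}. x j < x i}" and ?hi = "{j \<in> {1..n}. x i < x j}"
    have xi: "\<beta> 1 \<le> x i" "x i + w i \<le> \<beta> (Suc n)"
    proof -
      have "{x i..<x i + w i} \<subseteq> ?I" by (rule img_sub[OF i])
      then show "\<beta> 1 \<le> x i" "x i + w i \<le> \<beta> (Suc n)"
        using w[OF i] by (auto simp: ivl_subset)
    qed
    \<comment> \<open>The images left of the i-th one pack into the space to its left, those right
      of it into the space to its right. All lengths together fill the semi-interval, so both
      packings are tight, and \<open>x i\<close> is the partial sum that \<open>iet_delta\<close>
      asks for.\<close>
    have lo: "(\<Sum>j\<in>?lo. x j + w j - x j) \<le> x i - \<beta> 1"
    proof (rule semi_interval_packing)
      fix j assume j: "j \<in> ?lo"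
      then show "{x j..<x j + w j} \<subseteq> {\<beta> 1..<x i}" using img_sub[of j] order[of j i] i by auto
      show "x j \<le> x j + w j" using j w[of j] by simp
      fix k assume "k \<in> ?lo" "j \<noteq> k"
      then show "{x j..<x j + w j} \<inter> {x k..<x k + w k} = {}" using disj j by blast
    qed (use xi in auto)
    have hi: "(\<Sum>j\<in>?hi. x j + w j - x j) \<le> \<beta> (Suc n) - (x i + w i)"
    proof (rule semi_interval_packing)
      fix j assume j: "j \<in> ?hi"
      then show "{x j..<x j + w j} \<subseteq> {x i + w i..<\<beta> (Suc n)}" using img_sub[of j] order[of i j] i by auto
      show "x j \<le> x j + w j" using j w[of j] by simp
      fix k assume "k \<in> ?hi" "j \<noteq> k"
      then show "{x j..<x j + w j} \<inter> {x k..<x k + w k} = {}" using disj j by blast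
    qed (use xi in auto)
    have "x j < x i \<or> j = i \<or> x i < x j" if "j \<in> {1..n}" for j
      using x_inj[OF i that] by (metis linorder_less_linear)
    then have "{1..n} = ?lo \<union> insert i ?hi" using i by blast
    moreover have "sum w (?lo \<union> insert i ?hi) = sum w ?lo + (w i + sum w ?hi)"
      by (subst sum.union_disjoint) auto
    ultimately have "sum w ?lo + (w i + sum w ?hi) = \<beta> (Suc n) - \<beta> 1" using total by metis
    then have "sum w ?lo = x i - \<beta> 1" using lo hi by simp
    moreover have "{j \<in> {1..n}. \<sigma> j < \<sigma> i} = ?lo" using \<sigma>_iff[OF i] by blast
    ultimately show ?thesis by (simp add: iet_delta_def)
  qed
  interpret exchange D by unfold_locales (rule iet)
  have map: "iet_map D z = S z" if "z \<in> ?I" for z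
  proof -
    let ?i = "iet_letter D z"
    have l: "?i \<in> {1..n}" "z \<in> iet_interval D ?i" using letter[of z] that dom by auto
    have "iet_map D z = z + (iet_delta D ?i - iet_gamma D ?i)"
      by (rule map_on_interval) (use l in simp_all)
    moreover have "z \<in> {\<beta> ?i..<\<beta> (Suc ?i)}"
      using l(2) unfolding iet_interval_def gamma[OF l(1)] by (simp add: w_def)
    ultimately show ?thesis
      unfolding tr[OF l(1) \<open>z \<in> {\<beta> ?i..<\<beta> (Suc ?i)}\<close>] gamma[OF l(1)] delta[OF l(1)]
      by (simp only: x_def)
  qed
  show ?thesis by (rule exI[of _ D]) (use iet dom map in \<open>simp add: w_def\<close>)
qed

lemma subdivision_by_points:
  fixes u v :: real
  assumes fin: "finite X" and X: "X \<subseteq> {u<..<v}" and uv: "u < v"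
  obtains \<beta> where "\<beta> 1 = u" "\<beta> (Suc (Suc (card X))) = v"
    "\<And>i. i \<in> {1..Suc (card X)} \<Longrightarrow> \<beta> i \<in> insert u X \<and> \<beta> i < \<beta> (Suc i) \<and> {\<beta> i<..<\<beta> (Suc i)} \<inter> X = {}"
proof -
  define xs where "xs = sorted_list_of_set (insert u X)"
  define m where "m = Suc (card X)"
  have "u \<notin> X" using X by auto
  then have len: "length xs = m" using fin by (simp add: xs_def m_def)
  have set: "set xs = insert u X" using fin unfolding xs_def by (subst set_sorted_list_of_set) auto
  have strict: "xs ! i < xs ! j" if "i < j" "j < m" for i j
    using that strict_sorted_list_of_set[of "insert u X"] len unfolding xs_def sorted_wrt_iff_nth_less by auto
  have mem: "xs ! i \<in> insert u X" if "i < m" for i using that len set nth_mem by metis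
  define \<beta> where "\<beta> = (\<lambda>i. if i \<le> m then xs ! (i - 1) else v)"
  have "\<exists>k<m. u = xs ! k" using set len by (metis in_set_conv_nth insertI1)
  then obtain k where k: "k < m" "u = xs ! k" by blast
  have "k = 0"
  proof (rule ccontr)
    assume "k \<noteq> 0"
    then have "xs ! 0 < u" using strict[of 0 k] k by simp
    moreover have "u \<le> xs ! 0" using mem[of 0] X by (auto simp: m_def)
    ultimately show False by simp
  qed
  show thesis
  proof (rule that[of \<beta>])
    show "\<beta> 1 = u" using k \<open>k = 0\<close> by (simp add: \<beta>_def m_def)
    show "\<beta> (Suc (Suc (card X))) = v" by (simp add: \<beta>_def m_def)
    fix i assume "i \<in> {1..Suc (card X)}"
    then have i: "1 \<le> i" "i \<le> m" by (auto simp: m_def)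
    have b: "\<beta> i = xs ! (i - 1)" "\<beta> i \<in> insert u X" using i mem[of "i - 1"] by (auto simp: \<beta>_def)
    have "\<beta> i < \<beta> (Suc i)"
    proof (cases "i < m")
      case True
      then show ?thesis using strict[of "i - 1" i] i by (simp add: \<beta>_def)
    next
      case False
      then show ?thesis using b(2) X uv i by (auto simp: \<beta>_def)
    qed
    moreover have "{\<beta> i<..<\<beta> (Suc i)} \<inter> X = {}"
    proof (rule ccontr)
      assume "\<not> ?thesis"
      then obtain y where y: "\<beta> i < y" "y < \<beta> (Suc i)" "y \<in> X" by auto
      then obtain j where j: "j < m" "y = xs ! j" using set len by (metis in_set_conv_nth insertI2)
      have "\<not> j \<le> i - 1"
      proof
        assume "j \<le> i - 1"
        moreover have "i - 1 < m" using i by linarith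
        ultimately have "xs ! j \<le> xs ! (i - 1)" using strict[of j "i - 1"] by (fastforce simp: le_less)
        then show False using y(1) j(2) b(1) by simp
      qed
      moreover have "j < i"
      proof (cases "i < m")
        case True
        then have "xs ! j < xs ! i" using y(2) j by (simp add: \<beta>_def)
        then show ?thesis using strict[of i j] j(1) by (metis linorder_less_linear order_less_asym)
      next
        case False
        then show ?thesis using j i by simp
      qed
      ultimately show False by simp
    qed
    ultimately show "\<beta> i \<in> insert u X \<and> \<beta> i < \<beta> (Suc i) \<and> {\<beta> i<..<\<beta> (Suc i)} \<inter> X = {}" using b by blast
  qed
qed

section \<open>Induced transformations\<close>

context regular_exchange
begin

text \<open>Such a bound guarantees that the minima behind \<open>rho_plus\<close>,
  \<open>rho_minus\<close> and \<open>first_return\<close> are attained. In the end c is a constant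
  over \<open>v - u\<close>.\<close>

definition recurrent_within :: "real \<Rightarrow> real \<Rightarrow> real \<Rightarrow> bool" where
  "recurrent_within u v c \<longleftrightarrow>
     (\<forall>z\<in>\<Omega>. (\<exists>n>0. real n \<le> c \<and> P (int n) z \<in> {u<..<v}) \<and>
        (\<exists>n. real n \<le> c \<and> P (- int n) z \<in> {u<..<v}))"

lemma rho_plus:
  assumes "recurrent_within u v c" "z \<in> \<Omega>"
  shows "0 < rho_plus T u v z" "P (int (rho_plus T u v z)) z \<in> {u<..<v}"
    "real (rho_plus T u v z) \<le> c"
    "\<And>m. 0 < m \<Longrightarrow> m < rho_plus T u v z \<Longrightarrow> P (int m) z \<notin> {u<..<v}"
proof -
  let ?Q = "\<lambda>n. n > 0 \<and> P (int n) z \<in> {u<..<v}"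
  obtain n where n: "real n \<le> c" "?Q n" using assms unfolding recurrent_within_def by blast
  show "0 < rho_plus T u v z" "P (int (rho_plus T u v z)) z \<in> {u<..<v}"
    using LeastI[of ?Q, OF n(2)] unfolding rho_plus_def by auto
  show "real (rho_plus T u v z) \<le> c"
    using Least_le[of ?Q, OF n(2)] n(1) unfolding rho_plus_def by linarith
  show "P (int m) z \<notin> {u<..<v}" if "0 < m" "m < rho_plus T u v z" for m
    using not_less_Least[of m ?Q] that unfolding rho_plus_def by blast
qed

lemma rho_minus:
  assumes "recurrent_within u v c" "z \<in> \<Omega>"
  shows "P (- int (rho_minus T u v z)) z \<in> {u<..<v}"
    "real (rho_minus T u v z) \<le> c"
    "\<And>m. m < rho_minus T u v z \<Longrightarrow> P (- int m) z \<notin> {u<..<v}"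
proof -
  let ?Q = "\<lambda>n. P (- int n) z \<in> {u<..<v}"
  obtain n where n: "real n \<le> c" "?Q n" using assms unfolding recurrent_within_def by blast
  show "P (- int (rho_minus T u v z)) z \<in> {u<..<v}"
    using LeastI[of ?Q, OF n(2)] unfolding rho_minus_def .
  show "real (rho_minus T u v z) \<le> c"
    using Least_le[of ?Q, OF n(2)] n(1) unfolding rho_minus_def by linarith
  show "P (- int m) z \<notin> {u<..<v}" if "m < rho_minus T u v z" for m
    using not_less_Least[of m ?Q] that unfolding rho_minus_def by blast
qed

lemma neighbours_not_within:
  assumes "recurrent_within u v c" "z \<in> \<Omega>"
    "- int (rho_minus T u v z) < k" "k < int (rho_plus T u v z)"
  shows "P k z \<notin> {u<..<v}"
proof (cases "k > 0")
  case True
  then show ?thesis using rho_plus(4)[OF assms(1,2), of "nat k"] assms(4) by simp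
next
  case False
  then show ?thesis using rho_minus(3)[OF assms(1,2), of "nat (- k)"] assms(3) by simp
qed

text \<open>The last visit to ]u, v[, up to time 0, of the orbit of \<open>\<gamma> i\<close>. From
  there the orbit meets \<open>\<gamma> i\<close> (at once, if it lies in ]u,
  v[) before it returns to ]u, v[, so these are the possible interior discontinuities of the induced
  map.\<close>

definition break :: "real \<Rightarrow> real \<Rightarrow> nat \<Rightarrow> real" where
  "break u v i = P (- int (rho_minus T u v (\<gamma> i))) (\<gamma> i)"

lemma break_within:
  "recurrent_within u v c \<Longrightarrow> i \<in> {1..s} \<Longrightarrow> break u v i \<in> {u<..<v}"
  unfolding break_def using rho_minus(1) gamma_in_dom by blast

lemma break_eqI:
  assumes "recurrent_within u v c" "i \<in> {1..s}" "z \<in> {u<..<v}" "(f ^^ k) z = \<gamma> i"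
    "\<And>j. 0 < j \<Longrightarrow> j \<le> k \<Longrightarrow> (f ^^ j) z \<notin> {u<..<v}"
  shows "z = break u v i"
proof -
  have z: "P (- int m) (\<gamma> i) = (f ^^ (k - m)) z" if "m \<le> k" for m
  proof -
    have "P (- int m) (\<gamma> i) = P (- int m + int k) z" unfolding pow_add pow_nat assms(4) ..
    also have "- int m + int k = int (k - m)" using that by simp
    finally show ?thesis by (simp only: pow_nat)
  qed
  have "rho_minus T u v (\<gamma> i) = k"
    unfolding rho_minus_def
  proof (rule Least_equality)
    show "P (- int k) (\<gamma> i) \<in> {u<..<v}" using z[of k] assms(3) by simp
    fix m assume m: "P (- int m) (\<gamma> i) \<in> {u<..<v}"
    show "k \<le> m"
    proof (rule ccontr)
      assume "\<not> k \<le> m"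
      then show False using z[of m] assms(5)[of "k - m"] m by simp
    qed
  qed
  then show ?thesis unfolding break_def using z[of k] by simp
qed

text \<open>As \<open>lft \<le> u\<close>, the point \<open>\<gamma> 1\<close> is outside ]u, v[, so
  its break is found further back, beyond the \<open>\<gamma> j\<close> that \<open>f\<close> maps
  to \<open>lft\<close>; the two share it. This leaves breaks for only s - 1 indices, hence s
  pieces.\<close>

lemma break_1:
  assumes "recurrent_within u v c" "lft \<le> u"
  obtains j where "j \<in> {2..s}" "break u v 1 = break u v j"
proof -
  obtain j where j: "j \<in> {2..s}" "f (\<gamma> j) = lft" by (rule left_end_preimage)
  have 1: "1 \<in> {1..s}" using s_pos by simp
  let ?r = "rho_minus T u v (\<gamma> 1)"
  let ?z = "break u v 1"
  have z: "?z \<in> {u<..<v}" by (rule break_within[OF assms(1) 1])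
  have zr: "(f ^^ ?r) ?z = \<gamma> 1" unfolding break_def by (simp flip: pow_nat)
  have r: "?r \<noteq> 0"
  proof
    assume "?r = 0"
    then show False using z assms(2) gamma_1 unfolding break_def by simp
  qed
  then have "f ((f ^^ (?r - 1)) ?z) = f (\<gamma> j)"
    using zr j(2) gamma_1 by (cases ?r) auto
  then have e: "(f ^^ (?r - 1)) ?z = \<gamma> j" using bij_is_inj[OF map_bij] by (simp add: inj_eq)
  have "?z = break u v j"
  proof (rule break_eqI[OF assms(1) _ z e])
    show "j \<in> {1..s}" using j by auto
    fix i assume i: "0 < i" "i \<le> ?r - 1"
    have "(f ^^ i) ?z = P (int i + - int ?r) (\<gamma> 1)"
      unfolding break_def pow_add pow_nat ..
    also have "int i + - int ?r = - int (?r - i)" using i r by auto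
    finally have "(f ^^ i) ?z = P (- int (?r - i)) (\<gamma> 1)" .
    then show "(f ^^ i) ?z \<notin> {u<..<v}"
      using rho_minus(3)[OF assms(1) gamma_in_dom[OF 1], of "?r - i"] i r by auto
  qed
  then show thesis using that j by blast
qed

text \<open>This is what admissibility is made for, with an end of [u, v[ as the point of
  \<open>Div\<close>. The point z sits at time \<open>k - n\<close> on the orbit of some
  \<open>\<gamma> i\<close>. A time after \<open>- rho_minus\<close> would be strictly between two
  consecutive visits to ]u, v[; a time before it would make z visit ]u, v[ again within n steps. So
  z is the break itself.\<close>

lemma Div_break:
  assumes "recurrent_within u v c" "lft \<le> u" "z \<in> {u<..<v}" "(f ^^ n) z \<in> Div T u v"
    "\<And>j. 0 < j \<Longrightarrow> j \<le> n \<Longrightarrow> (f ^^ j) z \<notin> {u<..<v}"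
  shows "z \<in> break u v ` {2..s}"
proof -
  obtain i k where i: "i \<in> {1..s}" "(f ^^ n) z = P k (\<gamma> i)"
    and k: "- int (rho_minus T u v (\<gamma> i)) \<le> k" "k < int (rho_plus T u v (\<gamma> i))"
    using assms(4) unfolding Div_def iet_neighbours_def by blast
  let ?r = "rho_minus T u v (\<gamma> i)"
  note g = gamma_in_dom[OF i(1)]
  have z: "z = P (k - int n) (\<gamma> i)"
  proof -
    have "z = P (- int n) ((f ^^ n) z)" by (simp flip: pow_nat)
    also have "\<dots> = P (- int n + k) (\<gamma> i)" unfolding i(2) pow_add ..
    finally show ?thesis by (simp add: add.commute)
  qed
  have "k - int n = - int ?r"
  proof (rule ccontr)
    assume ne: "k - int n \<noteq> - int ?r"
    show False
    proof (cases "k - int n > - int ?r")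
      case True
      then show False using neighbours_not_within[OF assms(1) g, of "k - int n"] k z assms(3) by simp
    next
      case False
      then have lt: "k - int n < - int ?r" using ne by simp
      define j where "j = nat (- int ?r - (k - int n))"
      have j: "0 < j" "j \<le> n" "int j = - int ?r - (k - int n)" using lt k(1) by (auto simp: j_def)
      have "(f ^^ j) z = P (int j + (k - int n)) (\<gamma> i)" unfolding pow_add z pow_nat ..
      also have "int j + (k - int n) = - int ?r" using j(3) by simp
      finally show False using assms(5)[OF j(1,2)] rho_minus(1)[OF assms(1) g] by simp
    qed
  qed
  then have zb: "z = break u v i" unfolding break_def using z by simp
  show ?thesis
  proof (cases "i = 1")
    case True
    obtain j where "j \<in> {2..s}" "break u v 1 = break u v j" by (rule break_1[OF assms(1,2)])
    then show ?thesis using zb True by blast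
  next
    case False
    then show ?thesis using zb i(1) by auto
  qed
qed

lemma break_inj: "inj_on (break u v) {2..s}"
  unfolding break_def by (rule inj_onI) (use orbit_separation(1) in blast)

section \<open>The first-return map\<close>

lemma first_return:
  assumes "recurrent_within u v c" "z \<in> \<Omega>"
  shows "0 < first_return T u v z" "(f ^^ first_return T u v z) z \<in> {u..<v}"
    "\<And>m. 0 < m \<Longrightarrow> m < first_return T u v z \<Longrightarrow> (f ^^ m) z \<notin> {u..<v}"
proof -
  let ?Q = "\<lambda>n. n > 0 \<and> (f ^^ n) z \<in> {u..<v}"
  obtain n where "n > 0" "(f ^^ n) z \<in> {u<..<v}" 
    using assms unfolding recurrent_within_def pow_nat by blast
  then have n: "?Q n" by auto
  show "0 < first_return T u v z" "(f ^^ first_return T u v z) z \<in> {u..<v}"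
    using LeastI[of ?Q, OF n] unfolding first_return_def by auto
  show "(f ^^ m) z \<notin> {u..<v}" if "0 < m" "m < first_return T u v z" for m
    using not_less_Least[of m ?Q] that unfolding first_return_def by blast
qed

text \<open>If two points with the same image had different return times, one of them would be an
  earlier return of the other.\<close>

lemma first_return_inj:
  assumes "recurrent_within u v c" "{u..<v} \<subseteq> \<Omega>"
  shows "inj_on (\<lambda>z. (f ^^ first_return T u v z) z) {u..<v}"
proof (rule inj_onI)
  let ?n = "first_return T u v"
  have le: "x = y" if xy: "x \<in> {u..<v}" "y \<in> {u..<v}" "(f ^^ ?n x) x = (f ^^ ?n y) y" "?n x \<le> ?n y" for x y
  proof -
    have "(f ^^ ?n x) x = (f ^^ ?n x) ((f ^^ (?n y - ?n x)) y)"
      using xy(3,4) by (metis add_diff_inverse_nat comp_apply funpow_add not_less)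
    then have x: "x = (f ^^ (?n y - ?n x)) y" by (rule iter_inj)
    show "x = y"
    proof (cases "?n y - ?n x = 0")
      case True
      then show ?thesis using x by simp
    next
      case False
      have "y \<in> \<Omega>" "x \<in> \<Omega>" using xy assms(2) by auto
      then show ?thesis
        using first_return(3)[OF assms(1), of y "?n y - ?n x"] first_return(1)[OF assms(1), of x] first_return(1)[OF assms(1), of y]
          False x xy(1) by auto
    qed
  qed
  fix x y assume "x \<in> {u..<v}" "y \<in> {u..<v}" "(f ^^ ?n x) x = (f ^^ ?n y) y"
  then show "x = y" using le[of x y] le[of y x] by (metis nat_le_linear)
qed

text \<open>
  Until its first return, a semi-interval containing no break in its interior is
  cut neither by a separation point nor by an end of \<open>[u, v[\<close>.
\<close>

lemma first_return_translation:
  assumes rec: "recurrent_within u v c" and adm: "admissible T u v"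
    and pq: "p < q" "{p..<q} \<subseteq> {u..<v}" "{p<..<q} \<inter> break u v ` {2..s} = {}"
    and y: "y \<in> {p..<q}"
  shows "first_return T u v y = first_return T u v p \<and>
    (f ^^ first_return T u v y) y = y + ((f ^^ first_return T u v p) p - p)"
proof -
  have uv: "lft \<le> u" "u < v" "v \<le> rgt" "u \<in> Div T u v" "v \<in> Div T u v \<or> v = rgt"
    using adm unfolding admissible_def by auto
  have dom: "{u..<v} \<subseteq> \<Omega>" using uv by (auto simp: iet_dom_def)
  have bounds: "u \<le> p" "q \<le> v" using pq(1,2) by auto
  \<comment> \<open>As long as no point of [p, q[ has returned before time k, a cut at time k can
    only come from a break; induction on k then runs up to the return time of p.\<close>
  define Q where "Q k \<longleftrightarrow> (\<forall>y\<in>{p..<q}. \<forall>j. 0 < j \<and> j < k \<longrightarrow> (f ^^ j) y \<notin> {u..<v})" for k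
  have p\<Omega>: "p \<in> \<Omega>" using pq dom by auto
  have tr: "(f ^^ m) y = y + ((f ^^ m) p - p)" if "Q k" "m \<le> k" "y \<in> {p..<q}" for k m y
  proof (rule iter_translation[OF p\<Omega> _ _ that(3)])
    show "q \<le> rgt" using bounds uv by simp
    fix w k' i assume w: "w \<in> {p<..<q}" "k' < m" "i \<in> {2..s}"
    show "(f ^^ k') w \<noteq> \<gamma> i"
    proof
      assume e: "(f ^^ k') w = \<gamma> i"
      have "w = break u v i"
      proof (rule break_eqI[OF rec _ _ e])
        show "i \<in> {1..s}" "w \<in> {u<..<v}" using w bounds by auto
        fix j assume j: "0 < j" "j \<le> k'"
        have "(f ^^ j) w \<notin> {u..<v}" using \<open>Q k\<close> w j \<open>m \<le> k\<close> unfolding Q_def by auto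
        then show "(f ^^ j) w \<notin> {u<..<v}" by auto
      qed
      then show False using pq(3) w by blast
    qed
  qed
  have mem: "(f ^^ k) y \<in> {u..<v} \<longleftrightarrow> (f ^^ k) p \<in> {u..<v}" if "Q k" "y \<in> {p..<q}" for k y
  proof (rule cell_membership[where p = p and q = q and g = "f ^^ k"])
    show "(f ^^ k) w = w + ((f ^^ k) p - p)" if "w \<in> {p..<q}" for w
      by (rule tr[OF \<open>Q k\<close> order_refl that])
    show "(f ^^ k) w \<notin> {u, v}" if w: "w \<in> {p<..<q}" for w
    proof
      assume e: "(f ^^ k) w \<in> {u, v}"
      have "w \<in> {u<..<v}" using w bounds by auto
      have "(f ^^ k) w \<in> \<Omega>" using \<open>w \<in> {u<..<v}\<close> dom by auto
      \<comment> \<open>If v is the exceptional end \<open>rgt\<close>, it is outside the domain and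
        cannot be hit; the end that is hit therefore belongs to \<open>Div\<close>.\<close>
      then have "(f ^^ k) w \<in> Div T u v" using e uv by (auto simp: iet_dom_def)
      moreover have "(f ^^ j) w \<notin> {u<..<v}" if "0 < j" "j \<le> k" for j
      proof (cases "j = k")
        case True
        then show ?thesis using e by auto
      next
        case False
        then have "(f ^^ j) w \<notin> {u..<v}" using \<open>Q k\<close> w that unfolding Q_def by auto
        then show ?thesis by auto
      qed
      ultimately have "w \<in> break u v ` {2..s}"
        by (rule Div_break[OF rec uv(1) \<open>w \<in> {u<..<v}\<close>])
      then show False using pq(3) w by blast
    qed
  qed (use that pq(1) in auto)
  let ?n = "first_return T u v p"
  note n = first_return[OF rec p\<Omega>]
  have Q: "Q k" if "k \<le> ?n" for k
    using that
  proof (induction k)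
    case (Suc k)
    then have k: "Q k" "k < ?n" by auto
    show ?case
      unfolding Q_def
    proof (intro ballI allI impI)
      fix y j assume y: "y \<in> {p..<q}" and j: "0 < j \<and> j < Suc k"
      show "(f ^^ j) y \<notin> {u..<v}"
      proof (cases "j = k")
        case True
        then show ?thesis using mem[OF k(1) y] n(3)[of k] j k(2) by blast
      next
        case False
        then show ?thesis using k(1) y j unfolding Q_def by auto
      qed
    qed
  qed (simp add: Q_def)
  have "first_return T u v y = ?n"
    unfolding first_return_def[of T u v y]
  proof (rule Least_equality)
    show "0 < ?n \<and> (f ^^ ?n) y \<in> {u..<v}" using mem[OF Q[OF order_refl] y] n(1,2) by blast
    fix m assume m: "0 < m \<and> (f ^^ m) y \<in> {u..<v}"
    show "?n \<le> m"
    proof (rule ccontr)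
      assume "\<not> ?n \<le> m"
      then show False using Q[OF order_refl] y m unfolding Q_def by auto
    qed
  qed
  then show ?thesis using tr[OF Q[OF order_refl] order_refl y] by simp
qed

lemma induced_exchange:
  assumes rec: "recurrent_within u v c" and adm: "admissible T u v"
  obtains D where "is_iet D" "iet_num D = s" "induced_transformation T u v = iet_transformation D"
    "\<And>i. i \<in> {1..s} \<Longrightarrow> iet_len D i \<le> v - u"
    "\<And>i. i \<in> {1..s} \<Longrightarrow> \<exists>x y. {x, y} \<subseteq> insert u (insert v (break u v ` {2..s})) \<and> iet_len D i = y - x"
proof -
  have uv: "lft \<le> u" "u < v" "v \<le> rgt" using adm unfolding admissible_def by auto
  have dom: "{u..<v} \<subseteq> \<Omega>" using uv by (auto simp: iet_dom_def)
  let ?X = "break u v ` {2..s}"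
  let ?S = "\<lambda>z. (f ^^ first_return T u v z) z"
  \<comment> \<open>Breaks of different indices lie on disjoint orbits, so there are exactly s - 1
    of them.\<close>
  have card: "Suc (card ?X) = s" using card_image[OF break_inj] s_ge_2 by simp
  have X: "?X \<subseteq> {u<..<v}" using break_within[OF rec] by auto
  have fin: "finite ?X" by simp
  obtain \<beta> where "\<beta> 1 = u" "\<beta> (Suc (Suc (card ?X))) = v"
    "\<And>i. i \<in> {1..Suc (card ?X)} \<Longrightarrow> \<beta> i \<in> insert u ?X \<and> \<beta> i < \<beta> (Suc i) \<and> {\<beta> i<..<\<beta> (Suc i)} \<inter> ?X = {}"
    using subdivision_by_points[OF fin X uv(2)] by metis
  then have \<beta>: "\<beta> 1 = u" "\<beta> (Suc s) = v"
    "\<And>i. i \<in> {1..s} \<Longrightarrow> \<beta> i \<in> insert u ?X"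
    "\<And>i. i \<in> {1..s} \<Longrightarrow> \<beta> i < \<beta> (Suc i)"
    "\<And>i. i \<in> {1..s} \<Longrightarrow> {\<beta> i<..<\<beta> (Suc i)} \<inter> ?X = {}"
    unfolding card by blast+
  have next_point: "\<beta> (Suc i) \<in> insert v ?X" if i: "i \<in> {1..s}" for i
  proof (cases "i = s")
    case True
    then show ?thesis using \<beta>(2) by simp
  next
    case False
    then have "Suc i \<in> {1..s}" using i by auto
    moreover have "\<beta> (Suc i) \<noteq> u" using \<beta>(4)[OF i] \<beta>(3)[OF i] X by auto
    ultimately show ?thesis using \<beta>(3) by blast
  qed
  have in_uv: "u \<le> \<beta> i" "\<beta> (Suc i) \<le> v" if "i \<in> {1..s}" for i
    using \<beta>(3)[OF that] next_point[OF that] X uv by auto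
  have step: "?S z = z + (?S (\<beta> i) - \<beta> i)" if i: "i \<in> {1..s}" and z: "z \<in> {\<beta> i..<\<beta> (Suc i)}" for i z
    using first_return_translation[OF rec adm \<beta>(4)[OF i] _ \<beta>(5)[OF i] z] in_uv[OF i] by auto
  have "\<exists>D. is_iet D \<and> iet_num D = s \<and> iet_dom D = {\<beta> 1..<\<beta> (Suc s)} \<and>
    iet_len D = (\<lambda>i. \<beta> (Suc i) - \<beta> i) \<and> (\<forall>z\<in>{\<beta> 1..<\<beta> (Suc s)}. iet_map D z = ?S z)"
  proof (rule iet_of_piecewise_translation[of s \<beta> ?S])
    show "?S z \<in> {\<beta> 1..<\<beta> (Suc s)}" if "z \<in> {\<beta> 1..<\<beta> (Suc s)}" for z
      using first_return(2)[OF rec] that dom unfolding \<beta>(1,2) by blast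
    show "inj_on ?S {\<beta> 1..<\<beta> (Suc s)}" unfolding \<beta>(1,2) by (rule first_return_inj[OF rec dom])
  qed (fact s_pos \<beta>(4) step)+
  then obtain D where D: "is_iet D" "iet_num D = s" "iet_dom D = {\<beta> 1..<\<beta> (Suc s)}"
    "iet_len D = (\<lambda>i. \<beta> (Suc i) - \<beta> i)" "\<And>z. z \<in> {\<beta> 1..<\<beta> (Suc s)} \<Longrightarrow> iet_map D z = ?S z"
    by blast
  show thesis
  proof (rule that[OF D(1,2)])
    show "induced_transformation T u v = iet_transformation D"
      unfolding induced_transformation_def iet_transformation_def D(3) \<beta>(1,2)
      by (rule ext) (simp add: restrict_map_def D(5)[unfolded \<beta>(1,2)])
    fix i assume i: "i \<in> {1..s}"
    show "iet_len D i \<le> v - u" using in_uv[OF i] unfolding D(4) by simp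
    show "\<exists>x y. {x, y} \<subseteq> insert u (insert v ?X) \<and> iet_len D i = y - x"
      by (rule exI[of _ "\<beta> i"], rule exI[of _ "\<beta> (Suc i)"])
        (use \<beta>(3)[OF i] next_point[OF i] in \<open>auto simp: D(4)\<close>)
  qed
qed

end

section \<open>Finiteness\<close>

context quadratic_exchange
begin

lemma admissible_induced_lengths:
  obtains K where
    "\<And>u v. admissible T u v \<Longrightarrow> \<exists>D. is_iet D \<and> iet_num D = s \<and>
      induced_transformation T u v = iet_transformation D \<and>
      (\<forall>i\<in>{1..s}. iet_len D i \<le> v - u \<and> qint d N (K / (v - u)) (iet_len D i))"
proof -
  obtain C where C: "0 < C"
    "\<And>u v z. lft \<le> u \<Longrightarrow> u < v \<Longrightarrow> v \<le> rgt \<Longrightarrow> z \<in> \<Omega> \<Longrightarrow>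
      \<exists>n>0. real n \<le> C / (v - u) \<and> P (int n) z \<in> {u<..<v}"
    "\<And>u v z. lft \<le> u \<Longrightarrow> u < v \<Longrightarrow> v \<le> rgt \<Longrightarrow> z \<in> \<Omega> \<Longrightarrow>
      \<exists>n. real n \<le> C / (v - u) \<and> P (- int n) z \<in> {u<..<v}"
    using linear_return_time by metis
  let ?R = "rgt - lft"
  \<comment> \<open>The factor 2 comes from subtracting two end points, and \<open>C + ?R\<close>
    absorbs the 1 in \<open>c + 1\<close>, because \<open>1 \<le> ?R / (v - u)\<close>.\<close>
  let ?K = "2 * (C + ?R) * A"
  show thesis
  proof (rule that[of ?K])
    fix u v assume adm: "admissible T u v"
    then have uv: "lft \<le> u" "u < v" "v \<le> rgt" "u \<in> Div T u v" "v \<in> Div T u v \<or> v = rgt"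
      unfolding admissible_def by auto
    define c where "c = C / (v - u)"
    \<comment> \<open>At most c steps along an orbit cost \<open>c * A\<close>; the starting
      separation point, or the end \<open>rgt\<close>, costs \<open>A / 2\<close>, rounded up to
      \<open>A\<close>.\<close>
    define M where "M = (c + 1) * A"
    have c0: "0 \<le> c" using C(1) uv by (simp add: c_def)
    have rec: "recurrent_within u v c"
      unfolding recurrent_within_def c_def using C(2,3)[OF uv(1-3)] by blast
    have orbit_qint: "qint d N M (P k (\<gamma> i) - lft)" if "i \<in> {1..s}" "\<bar>real_of_int k\<bar> \<le> c" for i k
    proof -
      have "qint d N (\<bar>real_of_int k\<bar> * A + A / 2) ((P k (\<gamma> i) - \<gamma> i) + (\<gamma> i - lft))"
        by (intro qint_add qint_pow gamma_in_dom qint_gamma that)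
      moreover have "\<bar>real_of_int k\<bar> * A + A / 2 \<le> M"
        using mult_right_mono[OF that(2), of A] A_ge_1 unfolding M_def distrib_right by linarith
      ultimately show ?thesis using qint_mono by fastforce
    qed
    have div_qint: "qint d N M (x - lft)" if x: "x \<in> Div T u v" for x
    proof -
      obtain i k where i: "i \<in> {1..s}" "x = P k (\<gamma> i)"
        and k: "- int (rho_minus T u v (\<gamma> i)) \<le> k" "k < int (rho_plus T u v (\<gamma> i))"
        using x unfolding Div_def iet_neighbours_def by blast
      have "\<bar>real_of_int k\<bar> \<le> c"
        using rho_plus(3)[OF rec gamma_in_dom[OF i(1)]] rho_minus(2)[OF rec gamma_in_dom[OF i(1)]] k
        by linarith
      then show ?thesis using orbit_qint i by simp
    qed
    have break_qint: "qint d N M (break u v i - lft)" if "i \<in> {2..s}" for i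
      unfolding break_def
      by (rule orbit_qint) (use that rho_minus(2)[OF rec gamma_in_dom] in auto)
    have rgt_qint: "qint d N M (rgt - lft)"
    proof (rule qint_mono[OF qint_rgt])
      show "A / 2 \<le> M" using mult_right_mono[OF c0, of A] A_ge_1 unfolding M_def distrib_right by simp
    qed
    have qpts: "qint d N M (x - lft)" if "x \<in> insert u (insert v (break u v ` {2..s}))" for x
      using that div_qint break_qint rgt_qint uv(4,5) by blast
    obtain D where D: "is_iet D" "iet_num D = s" "induced_transformation T u v = iet_transformation D"
      "\<And>i. i \<in> {1..s} \<Longrightarrow> iet_len D i \<le> v - u"
      "\<And>i. i \<in> {1..s} \<Longrightarrow> \<exists>x y. {x, y} \<subseteq> insert u (insert v (break u v ` {2..s})) \<and> iet_len D i = y - x"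
      using induced_exchange[OF rec adm] by metis
    have MK: "M + M \<le> ?K / (v - u)"
    proof -
      have "1 \<le> ?R / (v - u)" using uv by simp
      then have "c + 1 \<le> (C + ?R) / (v - u)" by (simp add: c_def add_divide_distrib)
      then have "M \<le> (C + ?R) / (v - u) * A" unfolding M_def using A_ge_1 by (intro mult_right_mono) auto
      moreover have "?K / (v - u) = 2 * ((C + ?R) / (v - u) * A)" by simp
      ultimately show ?thesis by linarith
    qed
    have "qint d N (?K / (v - u)) (iet_len D i)" if i: "i \<in> {1..s}" for i
    proof -
      obtain x y where xy: "{x, y} \<subseteq> insert u (insert v (break u v ` {2..s}))" "iet_len D i = y - x"
        using D(5)[OF i] by blast
      have "qint d N (M + M) ((y - lft) - (x - lft))" by (intro qint_diff qpts) (use xy in auto)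
      then show ?thesis using qint_mono[OF _ MK] xy(2) by simp
    qed
    then show "\<exists>D. is_iet D \<and> iet_num D = s \<and>
      induced_transformation T u v = iet_transformation D \<and>
      (\<forall>i\<in>{1..s}. iet_len D i \<le> v - u \<and> qint d N (?K / (v - u)) (iet_len D i))"
      using D(1-4) by (intro exI[of _ D] conjI ballI) simp_all
  qed
qed

end

section \<open>From finitely many invariants to finitely many classes\<close>

lemma finite_representatives:
  assumes "finite (\<kappa> ` X)" "\<And>x y. x \<in> X \<Longrightarrow> y \<in> X \<Longrightarrow> \<kappa> x = \<kappa> y \<Longrightarrow> R x y"
  shows "\<exists>F. finite F \<and> F \<subseteq> X \<and> (\<forall>x\<in>X. \<exists>y\<in>F. R x y)"
proof -
  obtain F where F: "F \<subseteq> X" "finite F" "\<kappa> ` X = \<kappa> ` F"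
    using finite_subset_image[OF assms(1) order_refl] by metis
  have "\<exists>y\<in>F. R x y" if "x \<in> X" for x
  proof -
    have "\<kappa> x \<in> \<kappa> ` F" using that unfolding F(3)[symmetric] by (rule imageI)
    then obtain y where "y \<in> F" "\<kappa> x = \<kappa> y" by blast
    then show ?thesis using assms(2)[OF that] F(1) by blast
  qed
  then show ?thesis using F by blast
qed

text \<open>The lengths up to scaling. The function is extensional, since lengths outside
  \<open>{1..iet_num D}\<close> carry no information and \<open>finite_PiE\<close> is to count the
  possible values.\<close>

definition length_ratios :: "iet \<Rightarrow> nat \<Rightarrow> real" where
  "length_ratios D = (\<lambda>i\<in>{1..iet_num D}. iet_len D i / iet_len D 1)"

lemma iet_equiv_of_ratios:
  assumes "is_iet D" "is_iet E" "iet_num D = iet_num E" "iet_perm D = iet_perm E"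
    "length_ratios D = length_ratios E"
  shows "iet_equiv D E"
proof -
  have pos: "0 < iet_len D 1" "0 < iet_len E 1" using assms(1,2) unfolding is_iet_def by auto
  define c where "c = iet_len E 1 / iet_len D 1"
  have "0 < c" using pos by (simp add: c_def)
  have len: "iet_len E i = c * iet_len D i" if "i \<in> {1..iet_num D}" for i
  proof -
    have "iet_len D i / iet_len D 1 = iet_len E i / iet_len E 1"
      using fun_cong[OF assms(5), of i] that assms(3) by (simp add: length_ratios_def)
    then show ?thesis using pos by (simp add: c_def field_simps)
  qed
  have perm: "iet_perm E i = iet_perm D i" for i by (simp only: assms(4))
  have "\<forall>i\<in>{1..iet_num D}. iet_perm E i = iet_perm D i \<and> iet_len E i = c * iet_len D i"
    by (intro ballI conjI perm len)
  then show ?thesis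
    unfolding iet_equiv_def using \<open>0 < c\<close> assms(3) by blast
qed

text \<open>Length ratios and permutation together determine the class, and there are finitely many
  permutations. The family is abstract so that the lemma covers both one interval and
  several.\<close>

lemma finite_classes_of_presentations:
  assumes "\<And>S. S \<in> X \<Longrightarrow> \<exists>D. is_iet D \<and> iet_num D = n \<and> S = iet_transformation D \<and>
      length_ratios D \<in> Y"
    and "finite Y"
  shows "\<exists>F. finite F \<and> F \<subseteq> X \<and> (\<forall>S\<in>X. \<exists>R\<in>F. transformation_equiv n S R)"
proof -
  obtain D where D: "\<And>S. S \<in> X \<Longrightarrow> is_iet (D S)" "\<And>S. S \<in> X \<Longrightarrow> iet_num (D S) = n"
    "\<And>S. S \<in> X \<Longrightarrow> S = iet_transformation (D S)" "\<And>S. S \<in> X \<Longrightarrow> length_ratios (D S) \<in> Y"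
    using assms(1) by metis
  let ?k = "\<lambda>S. (length_ratios (D S), iet_perm (D S))"
  show ?thesis
  proof (rule finite_representatives[of ?k])
    have "?k ` X \<subseteq> Y \<times> {p. p permutes {1..n}}" using D(1,2,4) unfolding is_iet_def by auto
    moreover have "finite (Y \<times> {p. p permutes {1..n}})" using assms(2) by (simp add: finite_permutations)
    ultimately show "finite (?k ` X)" by (rule finite_subset)
    fix S R assume SR: "S \<in> X" "R \<in> X" "?k S = ?k R"
    have "iet_equiv (D S) (D R)" by (rule iet_equiv_of_ratios) (use SR D in auto)
    then show "transformation_equiv n S R" unfolding transformation_equiv_def using SR D by metis
  qed
qed

lemma (in quadratic_exchange) finite_classes:
  "\<exists>F. finite F \<and> F \<subseteq> admissible_induced T \<and>
     (\<forall>S\<in>admissible_induced T. \<exists>R\<in>F. transformation_equiv s S R)"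
proof -
  obtain K where K: "\<And>u v. admissible T u v \<Longrightarrow> \<exists>D. is_iet D \<and> iet_num D = s \<and>
      induced_transformation T u v = iet_transformation D \<and>
      (\<forall>i\<in>{1..s}. iet_len D i \<le> v - u \<and> qint d N (K / (v - u)) (iet_len D i))"
    using admissible_induced_lengths by metis
  let ?Q = "{x / y | x y L. L > 0 \<and> 0 < x \<and> x \<le> L \<and> 0 < y \<and> y \<le> L \<and>
      qint d N (K / L) x \<and> qint d N (K / L) y}"
  show ?thesis
  proof (rule finite_classes_of_presentations)
    show "finite ({1..s} \<rightarrow>\<^sub>E ?Q)" by (intro finite_PiE finite_ratios) simp
    fix S assume "S \<in> admissible_induced T"
    then obtain u v where uv: "admissible T u v" "S = induced_transformation T u v"
      unfolding admissible_induced_def by blast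
    obtain D where D: "is_iet D" "iet_num D = s" "S = iet_transformation D"
      "\<And>i. i \<in> {1..s} \<Longrightarrow> iet_len D i \<le> v - u \<and> qint d N (K / (v - u)) (iet_len D i)"
      using K[OF uv(1)] uv(2) by blast
    have pos: "0 < iet_len D i" if "i \<in> {1..s}" for i using D(1,2) that unfolding is_iet_def by auto
    have "1 \<in> {1..s}" "0 < v - u" using s_pos uv(1) unfolding admissible_def by auto
    then have "iet_len D i / iet_len D 1 \<in> ?Q" if "i \<in> {1..s}" for i
      using D(4)[OF that] D(4)[of 1] pos[OF that] pos[of 1] by blast
    then have "length_ratios D \<in> {1..s} \<rightarrow>\<^sub>E ?Q"
      unfolding length_ratios_def D(2) by (intro restrict_PiE_iff[THEN iffD2]) blast
    then show "\<exists>D. is_iet D \<and> iet_num D = s \<and> S = iet_transformation D \<and> length_ratios D \<in> {1..s} \<rightarrow>\<^sub>E ?Q"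
      using D by blast
  qed
qed

text \<open>
  For one interval, no iterate of the only separation point lies in \<open>]u, v[\<close>, so
  \<open>rho_plus\<close> and \<open>rho_minus\<close> are unspecified; the neighbours are in any case iterates of
  the fixed point \<open>iet_left T\<close>.
\<close>

lemma (in exchange) single_interval:
  assumes "s = 1"
  shows "admissible_induced T \<subseteq> {iet_transformation T}"
proof
  have id: "f z = z" for z
  proof (cases "z \<in> \<Omega>")
    case True
    have "iet_letter T z = 1" using letter(1)[OF True] assms by simp
    moreover have "{j \<in> {1..s}. \<pi> j < \<pi> 1} = {}" using assms by auto
    then have "\<delta> 1 = lft" unfolding iet_delta_def by (simp only: sum.empty add_0_right)
    ultimately show ?thesis using True gamma_1 by (simp add: iet_map_def)
  qed (simp add: iet_map_def)
  have idn: "(f ^^ n) z = z" for n z by (induction n) (simp_all add: id)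
  have idp: "P k z = z" for k z
  proof (cases "k \<ge> 0")
    case True
    then show ?thesis using idn[of "nat k" z] by (simp add: iet_pow_def)
  next
    case False
    have "P (- k) z = z" using False idn[of "nat (- k)" z] by (simp add: iet_pow_def)
    then show ?thesis using pow_inverse(1)[of "- k" z] by simp
  qed
  fix S assume "S \<in> admissible_induced T"
  then obtain u v where uv: "admissible T u v" "S = induced_transformation T u v"
    unfolding admissible_induced_def by blast
  have "Div T u v \<subseteq> {lft}"
    unfolding Div_def iet_neighbours_def idp using assms gamma_1 by auto
  then have "u = lft" "v = rgt" using uv(1) unfolding admissible_def by auto
  then show "S \<in> {iet_transformation T}"
    unfolding uv(2) induced_transformation_def iet_transformation_def idn id dom_interval by simp
qed

theorem theorem6:
  fixes T :: iet
  assumes "regular_iet T"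
    and "over_quadratic_field T"
  shows "\<exists>F. finite F \<and> F \<subseteq> admissible_induced T \<and>
           (\<forall>S\<in>admissible_induced T. \<exists>R\<in>F. transformation_equiv (iet_num T) S R)"
proof -
  have iet: "is_iet T" using assms(1) by (simp add: regular_iet_def)
  interpret exchange T by unfold_locales (rule iet)
  show ?thesis
  \<comment> \<open>Two intervals are needed for some separation point of index at least 2 to be
    mapped to \<open>lft\<close>, so one interval is treated apart.\<close>
  proof (cases "s = 1")
    case True
    show ?thesis
    proof (rule finite_classes_of_presentations[where Y = "{length_ratios T}"])
      fix S assume "S \<in> admissible_induced T"
      then have "S = iet_transformation T" using single_interval[OF True] by blast
      then show "\<exists>D. is_iet D \<and> iet_num D = s \<and> S = iet_transformation D \<and> length_ratios D \<in> {length_ratios T}"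
        using iet by blast
    qed simp
  next
    case False
    obtain d :: int where d: "d \<ge> 2" "squarefree d" "\<And>i. i \<in> {1..s} \<Longrightarrow> iet_len T i \<in> quadratic_field d"
      using assms(2) unfolding over_quadratic_field_def by blast
    obtain N B where N: "N > 0" "\<And>i. i \<in> {1..s} \<Longrightarrow> qint d N B (iet_len T i)"
      using quadratic_common_denominator[of "{1..s}" "iet_len T" d] d(3) by blast
    \<comment> \<open>The maximum with 1 makes \<open>A \<ge> 1\<close>, which the estimates use
      when they divide by \<open>A\<close> and round up.\<close>
    interpret quadratic_exchange T d N "max 1 B"
    proof unfold_locales
      show "infinite (iet_orbit T (\<gamma> i))" if "i \<in> {2..s}" for i
        using assms(1) that unfolding regular_iet_def by blast
      show "iet_orbit T (\<gamma> i) \<inter> iet_orbit T (\<gamma> j) = {}" if "i \<in> {2..s}" "j \<in> {2..s}" "i \<noteq> j" for i j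
        using assms(1) that unfolding regular_iet_def by blast
      show "2 \<le> s" using s_pos False by simp
      show "qint d N (max 1 B) (iet_len T i)" if "i \<in> {1..s}" for i
        using qint_mono[OF N(2)[OF that] max.cobounded2] .
    qed (use d N in auto)
    show ?thesis by (rule finite_classes)
  qed
qed

end
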